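(* Let $p$ and $q$ be primes such that $p = 40k + 33$ and $q = 40l + 27$ for some $k, l \in \mathbb{Z}$. If $5k + 25l + 21$ is a perfect square, then the elliptic curve $E_{pq}: y^2 = x^3 - 5pqx$ has rank one over $\mathbb{Q}$.
   Context: For an elliptic curve $E$ over a number field $\mathbb{K}$, the rank of $E$ over $\mathbb{K}$ is the integer $r \ge 0$ such that $E(\mathbb{K}) \cong \mathbb{Z}^r \oplus E(\mathbb{K})_{tors}$ (Mordell-Weil). A perfect square means the square of an integer. *)

theory Defs
  imports
    "HOL-Algebra.Product_Groups"
    "HOL-Computational_Algebra.Primes"
    "HOL-Computational_Algebra.Nth_Powers"
begin

text \<open>
  Elliptic curves in short Weierstrass form \<open>y\<^sup>2 = x\<^sup>3 + a x + b\<close> over a field \<open>K\<close> of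
  characteristic 0, together with the chord-and-tangent group structure on \<open>E(K)\<close>.
\<close>

definition elliptic_curve :: "'a::field_char_0 \<Rightarrow> 'a \<Rightarrow> bool" where
  "elliptic_curve a b \<longleftrightarrow> 4 * a ^ 3 + 27 * b ^ 2 \<noteq> 0"

datatype 'a point = Infinity | Affine 'a 'a

definition ec_points :: "'a::field_char_0 \<Rightarrow> 'a \<Rightarrow> 'a point set" where
  "ec_points a b = insert Infinity {Affine x y |x y. y ^ 2 = x ^ 3 + a * x + b}"

text \<open>
  The parameter \<open>b\<close> does not occur in the addition formulas. The case \<open>x\<^sub>1 = x\<^sub>2\<close>,
  \<open>y\<^sub>1 = - y\<^sub>2\<close> also covers doubling a point of order two; for points on the same curve,
  \<open>x\<^sub>1 = x\<^sub>2\<close> and \<open>y\<^sub>1 \<noteq> - y\<^sub>2\<close> force the two points to be equal with \<open>y\<^sub>1 \<noteq> 0\<close>,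
  and the slope is that of the tangent.
\<close>

fun ec_add :: "'a::field_char_0 \<Rightarrow> 'a point \<Rightarrow> 'a point \<Rightarrow> 'a point" where
  "ec_add a Infinity Q = Q"
| "ec_add a P Infinity = P"
| "ec_add a (Affine x1 y1) (Affine x2 y2) =
     (if x1 = x2 \<and> y1 = - y2 then Infinity
      else let m = (if x1 = x2 then (3 * x1 ^ 2 + a) / (2 * y1) else (y2 - y1) / (x2 - x1));
               x3 = m ^ 2 - x1 - x2
           in Affine x3 (m * (x1 - x3) - y1))"

definition ec_group :: "'a::field_char_0 \<Rightarrow> 'a \<Rightarrow> 'a point monoid" where
  "ec_group a b = \<lparr>carrier = ec_points a b, monoid.mult = ec_add a, one = Infinity\<rparr>"

definition torsion_subgroup :: "('a, 'm) monoid_scheme \<Rightarrow> ('a, 'm) monoid_scheme" where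
  "torsion_subgroup G =
     G\<lparr>carrier := {x \<in> carrier G. \<exists>n::nat. n > 0 \<and> x [^]\<^bsub>G\<^esub> n = \<one>\<^bsub>G\<^esub>}\<rparr>"

text \<open>
  The rank is a relation rather than a function, so that no default value
  is involved: \<open>G\<close> has rank \<open>r\<close> if it is isomorphic to \<open>\<int>\<^sup>r \<oplus> G\<^sub>t\<^sub>o\<^sub>r\<^sub>s\<close>.
\<close>

definition has_rank :: "('a, 'm) monoid_scheme \<Rightarrow> nat \<Rightarrow> bool" where
  "has_rank G r \<longleftrightarrow> G \<cong> product_group {..<r} (\<lambda>_. integer_group) \<times>\<times> torsion_subgroup G"

end

theory Submission
  imports
    Defs
    "HOL-Number_Theory.Quadratic_Reciprocity"
    "HOL-Computational_Algebra.Squarefree"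
begin

text \<open>
  Put \<open>D = 5 p q\<close>. The hypothesis says \<open>p + 5 q = 8 s\<^sup>2\<close>, so \<open>(4 s\<^sup>2, s (p - 5 q))\<close> is a rational
  point on \<open>y\<^sup>2 = x\<^sup>3 - D x\<close>. Quadratic residues modulo \<open>5\<close>, \<open>p\<close> and \<open>q\<close> show that \<open>x\<close> is
  \<open>1\<close> or \<open>- D\<close> times a square for every point with \<open>x \<noteq> 0\<close>, and that on the isogenous curve
  \<open>y\<^sup>2 = x\<^sup>3 + 4 D x\<close> it is \<open>1\<close>, \<open>D\<close>, \<open>2 p\<close> or \<open>10 q\<close> times a square. Adding \<open>(0, 0)\<close>, we may
  assume \<open>(x, y) = (u\<^sup>2, u w)\<close>; then \<open>2 (u\<^sup>2 + w)\<close> is an abscissa on the isogenous curve, the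
  point is a double when that number is a square, and adding the known point moves the class of \<open>2 p\<close>
  into the class of squares. Hence \<open>E(\<rat>)/2E(\<rat>)\<close> is represented by combinations of the known
  point and \<open>(0, 0)\<close>, and a height descent shows that some fixed multiple of every point is a multiple
  of the known point, which has infinite order because neither it nor its translate by \<open>(0, 0)\<close> is
  a double and \<open>(0, 0)\<close> is the only point of order two and not a double either.
\<close>

section \<open>The group law\<close>

text \<open>For a curve with a 2-isogeny, \<open>2 ^ r\<close> is a quarter of the product of the
  numbers of square classes met on the two curves. Here these numbers are 2 and 4, whence
  \<open>r = 1\<close>. No isogeny is constructed as a map; it enters only through explicit formulas
  for halving and adding points. The relation \<open>p + 5 * q = 8 * s ^ 2\<close> works in both
  directions. It yields the known point, because \<open>(2 * s) ^ 2\<close> is the mean of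
  \<open>p\<close> and \<open>5 * q\<close>; and it makes \<open>2 * q\<close> a nonresidue modulo
  \<open>p\<close>, which removes the classes \<open>2 * q\<close> and \<open>10 * p\<close> on the
  isogenous curve. So the classes left by signs and residues are exactly those that are realized.
  Since the rank is defined by a splitting into a free part and torsion, knowing the group modulo
  doubles is not enough: some fixed multiple of every point has to land in the cyclic group of the
  known point, and this is where heights are needed.\<close>

text \<open>
  Vieta's formulas for \<open>x\<^sup>3 + a x + b - (m x + c)\<^sup>2\<close>: they also record tangency, so that one relation
  covers chords and tangents.
\<close>

definition ec_line :: "'a::field_char_0 \<Rightarrow> 'a \<Rightarrow> 'a \<Rightarrow> 'a \<Rightarrow> 'a \<Rightarrow> 'a \<Rightarrow> 'a \<Rightarrow> bool" where
  "ec_line a b m c x1 x2 x3 \<longleftrightarrow> x1 + x2 + x3 = m ^ 2 \<and>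
     x1 * x2 + x1 * x3 + x2 * x3 = a - 2 * m * c \<and> x1 * x2 * x3 = c ^ 2 - b"

lemma eq_neg_self_iff: "w = - w \<longleftrightarrow> w = (0::'a::field_char_0)"
  by (simp add: eq_neg_iff_add_eq_0 flip: mult_2)

lemma ec_line_swap12: "ec_line a b m c x1 x2 x3 \<Longrightarrow> ec_line a b m c x2 x1 x3"
  by (simp add: ec_line_def algebra_simps)

lemma ec_line_swap23: "ec_line a b m c x1 x2 x3 \<Longrightarrow> ec_line a b m c x1 x3 x2"
  by (simp add: ec_line_def algebra_simps)

lemma ec_line_on_curve:
  assumes "ec_line a b m c x1 x2 x3"
  shows "(m * x1 + c) ^ 2 = x1 ^ 3 + a * x1 + b"
  using assms unfolding ec_line_def by Groebner_Basis.algebra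

lemma ec_line_derivative:
  assumes "ec_line a b m c x1 x2 x3"
  shows "3 * x1 ^ 2 + a - 2 * m * (m * x1 + c) = (x1 - x2) * (x1 - x3)"
  using assms unfolding ec_line_def by Groebner_Basis.algebra

text \<open>The discriminant is a polynomial combination of the cubic and its derivative, so the two
  have no common root.\<close>

lemma elliptic_curve_nonsingular:
  assumes "elliptic_curve a b" "x ^ 3 + a * x + b = 0"
  shows "3 * x ^ 2 + a \<noteq> 0"
proof
  assume "3 * x ^ 2 + a = 0"
  with assms(2) have "4 * a ^ 3 + 27 * b ^ 2 = 0" by Groebner_Basis.algebra
  with assms(1) show False by (simp add: elliptic_curve_def)
qed

lemma ec_line_not_opposite:
  assumes "elliptic_curve a b" "ec_line a b m c x x z"
  shows "m * x + c \<noteq> 0"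
proof
  assume y: "m * x + c = 0"
  have "x ^ 3 + a * x + b = 0"
    using ec_line_on_curve[OF assms(2)] y by simp
  moreover have "3 * x ^ 2 + a = 0"
    using ec_line_derivative[OF assms(2)] y by simp
  ultimately show False
    using elliptic_curve_nonsingular[OF assms(1)] by blast
qed

text \<open>Together with \<open>ec_line_exists\<close>, this trades the case split and the
  divisions in \<open>ec_add\<close> for one polynomial relation, symmetric in the three abscissas,
  so that identities about sums become ideal membership problems.\<close>

lemma ec_add_line:
  assumes "elliptic_curve a b" "ec_line a b m c x1 x2 x3"
  shows "ec_add a (Affine x1 (m * x1 + c)) (Affine x2 (m * x2 + c)) = Affine x3 (- (m * x3 + c))"
proof (cases "x1 = x2")
  case True
  have ny: "m * x1 + c \<noteq> 0"
    using ec_line_not_opposite assms True by blast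
  then have "m * x1 + c \<noteq> - (m * x1 + c)"
    by (subst eq_neg_self_iff)
  moreover have "3 * x1 ^ 2 + a = m * (2 * (m * x1 + c))"
    using ec_line_derivative[OF assms(2)] True by simp
  then have "(3 * x1 ^ 2 + a) / (2 * (m * x1 + c)) = m"
    using ny by (simp only: divide_eq_eq mult_eq_0_iff) simp
  moreover have "m ^ 2 - x1 - x1 = x3"
    using assms(2) True unfolding ec_line_def by Groebner_Basis.algebra
  ultimately show ?thesis
    using True by (simp add: Let_def algebra_simps)
next
  case False
  have "(m * x2 + c - (m * x1 + c)) / (x2 - x1) = m"
    using False by (simp add: field_simps)
  moreover have "m ^ 2 - x1 - x2 = x3"
    using assms(2) unfolding ec_line_def by Groebner_Basis.algebra
  ultimately show ?thesis
    using False by (simp add: Let_def algebra_simps)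
qed

lemma ec_line_exists:
  assumes "y1 ^ 2 = x1 ^ 3 + a * x1 + b" "y2 ^ 2 = x2 ^ 3 + a * x2 + b"
    and "\<not> (x1 = x2 \<and> y1 = - y2)"
  obtains m c x3 where "ec_line a b m c x1 x2 x3" "y1 = m * x1 + c" "y2 = m * x2 + c"
proof (cases "x1 = x2")
  case True
  with assms have "y1 ^ 2 = y2 ^ 2" "y1 \<noteq> - y2" by simp_all
  then have y: "y1 = y2" "y1 \<noteq> 0"
    by (auto simp: power2_eq_iff)
  define m where "m = (3 * x1 ^ 2 + a) / (2 * y1)"
  have m: "2 * m * y1 = 3 * x1 ^ 2 + a" using y by (simp add: m_def)
  have "ec_line a b m (y1 - m * x1) x1 x2 (m ^ 2 - x1 - x2)"
    unfolding ec_line_def True[symmetric]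
  proof (intro conjI)
    show "x1 + x1 + (m ^ 2 - x1 - x1) = m ^ 2" by simp
    show "x1 * x1 + x1 * (m ^ 2 - x1 - x1) + x1 * (m ^ 2 - x1 - x1) = a - 2 * m * (y1 - m * x1)"
      using m by Groebner_Basis.algebra
    show "x1 * x1 * (m ^ 2 - x1 - x1) = (y1 - m * x1) ^ 2 - b"
      using m assms(1) by Groebner_Basis.algebra
  qed
  then show ?thesis
    using that y True by fastforce
next
  case False
  define m where "m = (y2 - y1) / (x2 - x1)"
  have m: "m * (x2 - x1) = y2 - y1" using False by (simp add: m_def)
  \<comment> \<open>The difference of the two curve equations gives the second Vieta relation only
    up to the factor \<open>x2 - x1\<close>, which must be cancelled before the third relation can
    be derived.\<close>
  have c1: "(x2 - x1) * (x1 * x2 + (x1 + x2) * (m ^ 2 - x1 - x2)) = (x2 - x1) * (a - 2 * m * (y1 - m * x1))"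
    using m assms(1,2) by Groebner_Basis.algebra
  then have c1: "x1 * x2 + (x1 + x2) * (m ^ 2 - x1 - x2) = a - 2 * m * (y1 - m * x1)"
    using False by simp
  have "ec_line a b m (y1 - m * x1) x1 x2 (m ^ 2 - x1 - x2)"
    unfolding ec_line_def
  proof (intro conjI)
    show "x1 + x2 + (m ^ 2 - x1 - x2) = m ^ 2" by simp
    show "x1 * x2 + x1 * (m ^ 2 - x1 - x2) + x2 * (m ^ 2 - x1 - x2) = a - 2 * m * (y1 - m * x1)"
      using c1 by Groebner_Basis.algebra
    show "x1 * x2 * (m ^ 2 - x1 - x2) = (y1 - m * x1) ^ 2 - b"
      using c1 assms(1) by Groebner_Basis.algebra
  qed
  then show ?thesis
    by (rule that) (use m in \<open>simp_all add: algebra_simps\<close>)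
qed

text \<open>
  Write \<open>L\<^sub>i = y - m\<^sub>i x - c\<^sub>i\<close>. On the curve, \<open>L\<^sub>1 L\<^sub>3\<close> is divisible by \<open>x - u\<close>; restricting to the
  second line gives the claim after multiplication by \<open>(u - q) (u - r)\<close>. If a factor vanishes, the
  derivative of the cubic replaces the evaluation.
\<close>

lemma four_lines_key:
  assumes "elliptic_curve a b" "ec_line a b m1 c1 p q u" "ec_line a b m2 c2 q r v" "ec_line a b m3 c3 u r s"
    and "m1 * q + c1 = m2 * q + c2" "m3 * r + c3 = m2 * r + c2" "m3 * u + c3 = - (m1 * u + c1)"
  shows "(m2 - m1) * (m2 - m3) = v - u"
proof -
  consider "u \<noteq> q" "u \<noteq> r" | "u = q" "u \<noteq> r" | "u \<noteq> q" "u = r" | "u = q" "u = r" by blast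
  then show ?thesis
  proof cases
    case 1
    have "(u - q) * (u - r) * ((m2 - m1) * (m2 - m3) - (v - u)) = 0"
      using assms(2-) unfolding ec_line_def by Groebner_Basis.algebra
    with 1 show ?thesis by simp
  next
    case 2
    note d1 = ec_line_derivative[OF ec_line_swap12[OF assms(2)]]
      and d2 = ec_line_derivative[OF assms(3)]
    have "(u - r) * ((m2 - m1) * (m2 - m3) - (v - u)) = 0"
      using assms(5-) d1 d2 unfolding 2 by Groebner_Basis.algebra
    with 2 show ?thesis by simp
  next
    case 3
    note d2 = ec_line_derivative[OF ec_line_swap12[OF assms(3)]]
      and d3 = ec_line_derivative[OF assms(4)]
    have "(u - q) * ((m2 - m1) * (m2 - m3) - (v - u)) = 0"
      using assms(5-) d2 d3 unfolding 3 by Groebner_Basis.algebra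
    with 3 show ?thesis by simp
  next
    case 4
    \<comment> \<open>If all three points coincide, the ordinate there equals its own negative, so
      the second line would be tangent at a point of order two.\<close>
    have "m2 * u + c2 = 0"
      using assms(5-) 4 by Groebner_Basis.algebra
    then show ?thesis
      using assms(1,3) 4 ec_line_not_opposite by blast
  qed
qed

text \<open>
  The quotient \<open>L\<^sub>1 L\<^sub>3 / (x - u)\<close> vanishes at the same points as \<open>L\<^sub>2 L\<^sub>4 / (x - v)\<close>; comparing the
  coefficients of \<open>y\<close> gives the slope \<open>m\<^sub>1 + m\<^sub>3 - m\<^sub>2\<close> of the fourth line. This is associativity.
\<close>

lemma fourth_line:
  assumes "elliptic_curve a b" "ec_line a b m1 c1 p q u" "ec_line a b m2 c2 q r v" "ec_line a b m3 c3 u r s"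
    and "m1 * q + c1 = m2 * q + c2" "m3 * r + c3 = m2 * r + c2" "m3 * u + c3 = - (m1 * u + c1)"
  obtains m4 c4 where "ec_line a b m4 c4 p v s" "m4 * p + c4 = m1 * p + c1"
    "m4 * v + c4 = - (m2 * v + c2)" "m4 * s + c4 = m3 * s + c3"
proof
  define m4 where "m4 = m1 + m3 - m2"
  define c4 where "c4 = - (m2 * v + c2) - m4 * v"
  note k = four_lines_key[OF assms]
  have s: "p + q + u = m1 ^ 2" "q + r + v = m2 ^ 2" "u + r + s = m3 ^ 2"
    using assms(2-4) by (auto simp: ec_line_def)
  show P: "m4 * p + c4 = m1 * p + c1"
    unfolding m4_def c4_def using k s assms(5-) by Groebner_Basis.algebra
  show "m4 * v + c4 = - (m2 * v + c2)" by (simp add: c4_def)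
  show "m4 * s + c4 = m3 * s + c3"
    unfolding m4_def c4_def using k s assms(5-) by Groebner_Basis.algebra
  have e1: "p + v + s = m4 ^ 2"
    unfolding m4_def using k s by Groebner_Basis.algebra
  have e2: "p * v + p * s + v * s = a - 2 * m4 * c4"
    unfolding m4_def c4_def using k assms(2-) unfolding ec_line_def by Groebner_Basis.algebra
  \<comment> \<open>Two Vieta relations and one known common point of line and curve determine the
    third relation.\<close>
  have "(m4 * p + c4) ^ 2 = p ^ 3 + a * p + b"
    using ec_line_on_curve[OF assms(2)] P by simp
  with e1 e2 have "p * v * s = c4 ^ 2 - b" by Groebner_Basis.algebra
  with e1 e2 show "ec_line a b m4 c4 p v s" by (simp add: ec_line_def)
qed

section \<open>Negation and the group axioms\<close>

fun ec_neg :: "'a::field_char_0 point \<Rightarrow> 'a point" where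
  "ec_neg Infinity = Infinity"
| "ec_neg (Affine x y) = Affine x (- y)"

lemma ec_neg_neg [simp]: "ec_neg (ec_neg P) = P"
  by (cases P) auto

lemma Affine_in_ec_points [simp]: "Affine x y \<in> ec_points a b \<longleftrightarrow> y ^ 2 = x ^ 3 + a * x + b"
  by (simp add: ec_points_def)

lemma Infinity_in_ec_points [simp]: "Infinity \<in> ec_points a b"
  by (simp add: ec_points_def)

lemma ec_neg_in_ec_points [simp]: "ec_neg P \<in> ec_points a b \<longleftrightarrow> P \<in> ec_points a b"
  by (cases P) auto

lemma ec_add_Infinity [simp]: "ec_add a P Infinity = P"
  by (cases P) auto

lemma ec_add_neg [simp]: "ec_add a P (ec_neg P) = Infinity" "ec_add a (ec_neg P) P = Infinity"
  by (cases P; simp)+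

declare ec_add.simps(3) [simp del]

lemma ec_add_cases [case_names left right opposite line]:
  assumes "P \<in> ec_points a b" "Q \<in> ec_points a b"
  obtains "P = Infinity" | "Q = Infinity" | "Q = ec_neg P"
  | m c x1 x2 x3 where "ec_line a b m c x1 x2 x3" "P = Affine x1 (m * x1 + c)" "Q = Affine x2 (m * x2 + c)"
proof (cases P; cases Q)
  fix x1 y1 x2 y2
  assume *: "P = Affine x1 y1" "Q = Affine x2 y2"
  show ?thesis
  proof (cases "x1 = x2 \<and> y1 = - y2")
    case True
    then show ?thesis using * that(3) by simp
  next
    case False
    then obtain m c x3 where "ec_line a b m c x1 x2 x3" "y1 = m * x1 + c" "y2 = m * x2 + c"
      using ec_line_exists assms * by (metis Affine_in_ec_points)
    then show ?thesis using * that(4) by simp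
  qed
qed (use that in auto)

lemma ec_line_collinear:
  assumes "elliptic_curve a b" "ec_line a b m c x1 x2 x3"
  shows "ec_add a (Affine x1 (m * x1 + c)) (Affine x2 (m * x2 + c)) = ec_neg (Affine x3 (m * x3 + c))"
    "ec_add a (Affine x1 (m * x1 + c)) (Affine x3 (m * x3 + c)) = ec_neg (Affine x2 (m * x2 + c))"
    "ec_add a (Affine x2 (m * x2 + c)) (Affine x3 (m * x3 + c)) = ec_neg (Affine x1 (m * x1 + c))"
    "ec_add a (Affine x2 (m * x2 + c)) (Affine x1 (m * x1 + c)) = ec_neg (Affine x3 (m * x3 + c))"
    "ec_add a (Affine x3 (m * x3 + c)) (Affine x1 (m * x1 + c)) = ec_neg (Affine x2 (m * x2 + c))"
    "ec_add a (Affine x3 (m * x3 + c)) (Affine x2 (m * x2 + c)) = ec_neg (Affine x1 (m * x1 + c))"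
proof -
  note l = assms(2) ec_line_swap23[OF assms(2)] ec_line_swap23[OF ec_line_swap12[OF assms(2)]]
  note add = l[THEN ec_add_line[OF assms(1)]] l[THEN ec_line_swap12, THEN ec_add_line[OF assms(1)]]
  show "ec_add a (Affine x1 (m * x1 + c)) (Affine x2 (m * x2 + c)) = ec_neg (Affine x3 (m * x3 + c))"
    "ec_add a (Affine x1 (m * x1 + c)) (Affine x3 (m * x3 + c)) = ec_neg (Affine x2 (m * x2 + c))"
    "ec_add a (Affine x2 (m * x2 + c)) (Affine x3 (m * x3 + c)) = ec_neg (Affine x1 (m * x1 + c))"
    "ec_add a (Affine x2 (m * x2 + c)) (Affine x1 (m * x1 + c)) = ec_neg (Affine x3 (m * x3 + c))"
    "ec_add a (Affine x3 (m * x3 + c)) (Affine x1 (m * x1 + c)) = ec_neg (Affine x2 (m * x2 + c))"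
    "ec_add a (Affine x3 (m * x3 + c)) (Affine x2 (m * x2 + c)) = ec_neg (Affine x1 (m * x1 + c))"
    unfolding ec_neg.simps by (rule add)+
qed

lemma ec_line_points:
  assumes "ec_line a b m c x1 x2 x3"
  shows "Affine x1 (m * x1 + c) \<in> ec_points a b" "Affine x2 (m * x2 + c) \<in> ec_points a b"
    "Affine x3 (m * x3 + c) \<in> ec_points a b"
  unfolding Affine_in_ec_points
  using ec_line_on_curve[OF assms] ec_line_on_curve[OF ec_line_swap12[OF assms]]
    ec_line_on_curve[OF ec_line_swap12[OF ec_line_swap23[OF assms]]] by this

lemma ec_add_closed:
  assumes "elliptic_curve a b" "P \<in> ec_points a b" "Q \<in> ec_points a b"
  shows "ec_add a P Q \<in> ec_points a b"
  using assms(2,3)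
proof (cases rule: ec_add_cases)
  case (line m c x1 x2 x3)
  then show ?thesis
    using ec_line_collinear(1)[OF assms(1) line(1)] ec_line_points(3)[OF line(1)]
    by (simp del: ec_neg.simps ec_add.simps Affine_in_ec_points)
qed (use assms in auto)

lemma ec_add_commute:
  assumes "elliptic_curve a b" "P \<in> ec_points a b" "Q \<in> ec_points a b"
  shows "ec_add a P Q = ec_add a Q P"
  using assms(2,3)
proof (cases rule: ec_add_cases)
  case (line m c x1 x2 x3)
  then show ?thesis
    using ec_line_collinear(1,4)[OF assms(1) line(1)] by (simp del: ec_neg.simps ec_add.simps)
qed auto

lemma ec_add_neg_distrib:
  assumes "elliptic_curve a b" "P \<in> ec_points a b" "Q \<in> ec_points a b"
  shows "ec_add a (ec_neg P) (ec_neg Q) = ec_neg (ec_add a P Q)"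
  using assms(2,3)
proof (cases rule: ec_add_cases)
  case (line m c x1 x2 x3)
  then have neg: "ec_line a b (- m) (- c) x1 x2 x3"
    by (simp add: ec_line_def)
  show ?thesis
    using ec_line_collinear(1)[OF assms(1) neg] ec_line_collinear(1)[OF assms(1) line(1)] line(2,3) by simp
qed auto

text \<open>The degenerate instance of associativity, with a vertical line among those involved. It
  has to come first, because the argument with four lines needs all of them to have a slope.\<close>

lemma ec_add_neg_cancel:
  assumes "elliptic_curve a b" "P \<in> ec_points a b" "Q \<in> ec_points a b"
  shows "ec_add a (ec_neg P) (ec_add a P Q) = Q"
  using assms(2,3)
proof (cases rule: ec_add_cases)
  case (line m c x1 x2 x3)
  define R where "R = Affine x3 (m * x3 + c)"
  have "ec_add a P Q = ec_neg R" "ec_add a P R = ec_neg Q"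
    using ec_line_collinear(1,2)[OF assms(1) line(1)] line(2,3) by (simp_all only: R_def)
  moreover have "R \<in> ec_points a b"
    using ec_line_points(3)[OF line(1)] by (simp only: R_def)
  ultimately show ?thesis
    using ec_add_neg_distrib[OF assms(1,2), of R] by simp
qed auto

text \<open>If none of the pairs \<open>P, Q\<close>, then \<open>Q, R\<close>, then
  \<open>P + Q, R\<close> is opposite, three lines are given and \<open>fourth_line\<close> supplies
  the one through \<open>P\<close> and \<open>Q + R\<close>, which meets the curve in the same last
  point. The other cases reduce to cancellation.\<close>

lemma ec_add_assoc:
  assumes E: "elliptic_curve a b" and P: "P \<in> ec_points a b" and Q: "Q \<in> ec_points a b" and R: "R \<in> ec_points a b"
  shows "ec_add a (ec_add a P Q) R = ec_add a P (ec_add a Q R)"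
  using P Q
proof (cases rule: ec_add_cases)
  case opposite
  then show ?thesis
    using ec_add_neg_cancel[OF E, of "ec_neg P" R] P R by simp
next
  case PQ: (line m1 c1 p q u)
  note U = ec_line_collinear[OF E PQ(1), folded PQ(2,3)] 
  from Q R show ?thesis
  proof (cases rule: ec_add_cases)
    case opposite
    have "ec_add a (ec_neg Q) (ec_add a Q P) = P"
      using E Q P by (rule ec_add_neg_cancel)
    then show ?thesis
      using ec_add_commute[OF E] ec_add_closed[OF E P Q] P Q R opposite
      by (metis ec_add_Infinity ec_add_neg(1))
  next
    case QR: (line m2 c2 q' r v)
    have q: "q' = q" "m1 * q + c1 = m2 * q + c2"
      using PQ(3) QR(2) by auto
    have l2: "ec_line a b m2 c2 q r v" using QR(1) q by simp
    note V = ec_line_collinear[OF E l2, folded QR(3)]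
    define U where "U = Affine u (m1 * u + c1)"
    have Uc: "ec_neg U \<in> ec_points a b"
      using ec_line_points(3)[OF PQ(1)] by (simp add: U_def del: ec_neg.simps Affine_in_ec_points)
    from Uc R show ?thesis
    proof (cases rule: ec_add_cases)
      case opposite
      then have R: "R = U" by simp
      have "ec_add a Q U = ec_neg P" "ec_add a P Q = ec_neg U"
        using U(1,3) PQ(2) by (simp_all only: U_def)
      then show ?thesis using R by simp
    next
      case UR: (line m3 c3 u' r' s)
      have *: "u' = u" "r' = r" "m3 * u + c3 = - (m1 * u + c1)" "m3 * r + c3 = m2 * r + c2"
        using UR(2,3) QR(3) unfolding U_def by auto
      have l3: "ec_line a b m3 c3 u r s" using UR(1) * by simp
      obtain m4 c4 where l4: "ec_line a b m4 c4 p v s" "m4 * p + c4 = m1 * p + c1"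
        "m4 * v + c4 = - (m2 * v + c2)" "m4 * s + c4 = m3 * s + c3"
        using fourth_line[OF E PQ(1) l2 l3 q(2) *(4,3)] by metis
      have "ec_add a (ec_add a P Q) R = ec_add a (ec_neg U) R"
        using U by (simp add: U_def)
      also have "\<dots> = ec_neg (Affine s (m3 * s + c3))"
        using ec_line_collinear(1)[OF E l3] UR * by simp
      also have "\<dots> = ec_add a P (ec_neg (Affine v (m2 * v + c2)))"
        using ec_line_collinear(1)[OF E l4(1)] PQ l4 by simp
      also have "\<dots> = ec_add a P (ec_add a Q R)"
        using V PQ q by simp
      finally show ?thesis .
    qed (auto simp: U_def QR)
  qed (use PQ in auto)
qed auto

lemma comm_group_ec_group:
  assumes "elliptic_curve a b"
  shows "comm_group (ec_group a b)"
proof (rule comm_groupI)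
  fix P assume "P \<in> carrier (ec_group a b)"
  then show "\<exists>Q\<in>carrier (ec_group a b). Q \<otimes>\<^bsub>ec_group a b\<^esub> P = \<one>\<^bsub>ec_group a b\<^esub>"
    by (intro bexI[of _ "ec_neg P"]) (auto simp: ec_group_def)
qed (use assms in \<open>auto simp: ec_group_def ec_add_closed ec_add_assoc intro: ec_add_commute\<close>)

section \<open>Abelian groups of rank one\<close>

lemma (in comm_group) torsion_subgroup_group: "group (torsion_subgroup G)"
proof -
  have "subgroup {x \<in> carrier G. \<exists>n::nat. n > 0 \<and> x [^] n = \<one>} G"
  proof (rule subgroupI)
    fix x y assume "x \<in> {x \<in> carrier G. \<exists>n::nat. n > 0 \<and> x [^] n = \<one>}"
      "y \<in> {x \<in> carrier G. \<exists>n::nat. n > 0 \<and> x [^] n = \<one>}"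
    then obtain m n :: nat where *: "x \<in> carrier G" "y \<in> carrier G" "m > 0" "n > 0" "x [^] m = \<one>" "y [^] n = \<one>"
      by auto
    have "x [^] (m * n) = (x [^] m) [^] n" "y [^] (m * n) = (y [^] n) [^] m"
      using *(1,2) by (simp_all add: nat_pow_pow mult.commute)
    then have "(x \<otimes> y) [^] (m * n) = \<one>" using * by (simp add: pow_mult_distrib m_comm)
    then show "x \<otimes> y \<in> {x \<in> carrier G. \<exists>n::nat. n > 0 \<and> x [^] n = \<one>}"
      using * by (auto intro!: exI[of _ "m * n"])
  next
    fix x assume "x \<in> {x \<in> carrier G. \<exists>n::nat. n > 0 \<and> x [^] n = \<one>}"
    then show "inv x \<in> {x \<in> carrier G. \<exists>n::nat. n > 0 \<and> x [^] n = \<one>}"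
      by (auto simp: nat_pow_inv)
  qed (auto intro!: exI[of _ \<one>] exI[of _ "1::nat"])
  then show ?thesis
    unfolding torsion_subgroup_def by (rule subgroup.subgroup_is_group) (rule group_axioms)
qed

text \<open>The exponent \<open>n\<close> with \<open>x [^] M = P [^] n\<close> is unique, hence a
  homomorphism \<open>\<theta>\<close> to the integers. Its kernel is the torsion subgroup and its
  image is infinite cyclic, so an element over a generator of the image splits the group.\<close>

lemma (in comm_group) has_rank_1I:
  fixes P :: 'a and M :: nat
  assumes P: "P \<in> carrier G" and inf: "\<And>n::int. P [^] n = \<one> \<Longrightarrow> n = 0"
    and M: "M > 0" "\<And>x. x \<in> carrier G \<Longrightarrow> \<exists>n::int. x [^] M = P [^] n"
  shows "has_rank G 1"
proof -
  have inj: "m = n" if "P [^] m = P [^] n" for m n :: int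
  proof -
    have "P [^] (m - n) = \<one>" using that P by (simp add: int_pow_diff)
    from inf[OF this] show ?thesis by simp
  qed
  have "\<forall>x\<in>carrier G. \<exists>n::int. x [^] M = P [^] n" using M(2) by blast
  then obtain \<theta> :: "'a \<Rightarrow> int" where \<theta>: "\<And>x. x \<in> carrier G \<Longrightarrow> x [^] M = P [^] \<theta> x"
    by metis
  have \<theta>I: "\<theta> x = n" if "x \<in> carrier G" "x [^] M = P [^] n" for x n
    using \<theta>[OF that(1)] that(2) inj by simp
  have \<theta>_mult: "\<theta> (x \<otimes> y) = \<theta> x + \<theta> y" if "x \<in> carrier G" "y \<in> carrier G" for x y
  proof (rule \<theta>I)
    have "(x \<otimes> y) [^] M = x [^] M \<otimes> y [^] M"
      using that by (simp add: pow_mult_distrib m_comm)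
    then show "(x \<otimes> y) [^] M = P [^] (\<theta> x + \<theta> y)"
      using that P by (simp add: \<theta> int_pow_mult)
  qed (use that in simp)
  have \<theta>_pow: "\<theta> (x [^] n) = n * \<theta> x" if "x \<in> carrier G" for x and n :: int
  proof (rule \<theta>I)
    have "(x [^] n) [^] M = (x [^] M) [^] n"
      using that by (simp add: int_pow_pow mult.commute flip: int_pow_int)
    then show "(x [^] n) [^] M = P [^] (n * \<theta> x)"
      using that P by (simp add: \<theta> int_pow_pow mult.commute)
  qed (use that in simp)
  have tors: "(\<exists>n::nat. n > 0 \<and> x [^] n = \<one>) \<longleftrightarrow> \<theta> x = 0" if "x \<in> carrier G" for x
  proof
    assume "\<exists>n::nat. n > 0 \<and> x [^] n = \<one>"
    then obtain n :: nat where n: "n > 0" "x [^] int n = \<one>" by (auto simp: int_pow_int)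
    have "\<theta> \<one> = 0" by (rule \<theta>I) auto
    then show "\<theta> x = 0" using \<theta>_pow[OF that, of "int n"] n by simp
  next
    assume "\<theta> x = 0"
    then show "\<exists>n::nat. n > 0 \<and> x [^] n = \<one>" using \<theta>[OF that] M by auto
  qed
  have "\<theta> P = int M" using P by (intro \<theta>I) (auto simp: int_pow_int)
  then have ex: "\<exists>n. n > 0 \<and> (\<exists>x\<in>carrier G. \<theta> x = int n)" using M P by blast
  \<comment> \<open>The least positive value generates the image of \<open>\<theta>\<close>: the
    remainder of any other value modulo \<open>d\<close> is again a value, so it must
    vanish.\<close>
  define d where "d = (LEAST n. n > 0 \<and> (\<exists>x\<in>carrier G. \<theta> x = int n))"
  have d: "d > 0" "\<exists>x\<in>carrier G. \<theta> x = int d"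
    using LeastI_ex[OF ex] by (auto simp: d_def)
  then obtain g where g: "g \<in> carrier G" "\<theta> g = int d" by blast
  have split: "\<theta> (x \<otimes> g [^] (- (\<theta> x div int d))) = 0" if "x \<in> carrier G" for x
  proof (rule ccontr)
    let ?y = "x \<otimes> g [^] (- (\<theta> x div int d))"
    have y: "\<theta> ?y = \<theta> x mod int d"
      using that g by (simp add: \<theta>_mult \<theta>_pow minus_div_mult_eq_mod[symmetric])
    assume "\<theta> ?y \<noteq> 0"
    then have "\<theta> ?y > 0" using y d by (metis pos_mod_sign of_nat_0_less_iff order_le_less)
    then have "nat (\<theta> ?y) > 0 \<and> (\<exists>x\<in>carrier G. \<theta> x = int (nat (\<theta> ?y)))"
      using that g by (intro conjI bexI[of _ ?y]) auto
    then have "d \<le> nat (\<theta> ?y)" unfolding d_def by (rule Least_le)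
    then show False using y d pos_mod_bound[of "int d" "\<theta> x"] by linarith
  qed
  let ?Z = "product_group {..<1::nat} (\<lambda>_. integer_group)"
  define \<Phi> where "\<Phi> = (\<lambda>(f :: nat \<Rightarrow> int, t). g [^] f 0 \<otimes> t)"
  have carr: "carrier (torsion_subgroup G) = {x \<in> carrier G. \<theta> x = 0}"
    using tors by (auto simp: torsion_subgroup_def)
  have "\<Phi> \<in> iso (?Z \<times>\<times> torsion_subgroup G) G"
  proof (rule isoI)
    show "\<Phi> \<in> hom (?Z \<times>\<times> torsion_subgroup G) G"
    proof (rule homI)
      fix u v assume *: "u \<in> carrier (?Z \<times>\<times> torsion_subgroup G)" "v \<in> carrier (?Z \<times>\<times> torsion_subgroup G)"
      obtain f t f' t' where uv: "u = (f, t)" "v = (f', t')" by (cases u; cases v)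
      have t: "t \<in> carrier G" "t' \<in> carrier G"
        using * by (auto simp: uv DirProd_def carr)
      have "\<Phi> (u \<otimes>\<^bsub>?Z \<times>\<times> torsion_subgroup G\<^esub> v) = g [^] (f 0 + f' 0) \<otimes> (t \<otimes> t')"
        by (simp add: \<Phi>_def uv DirProd_def torsion_subgroup_def integer_group_def)
      also have "\<dots> = \<Phi> u \<otimes> \<Phi> v"
        using t g by (simp add: \<Phi>_def uv int_pow_mult m_ac)
      finally show "\<Phi> (u \<otimes>\<^bsub>?Z \<times>\<times> torsion_subgroup G\<^esub> v) = \<Phi> u \<otimes> \<Phi> v" .
    qed (use g in \<open>auto simp: \<Phi>_def DirProd_def carr\<close>)
    have "inj_on \<Phi> (carrier (?Z \<times>\<times> torsion_subgroup G))"
    proof (rule inj_onI, clarify)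
      fix f t f' t'
      assume *: "(f, t) \<in> carrier (?Z \<times>\<times> torsion_subgroup G)" "(f', t') \<in> carrier (?Z \<times>\<times> torsion_subgroup G)"
        "\<Phi> (f, t) = \<Phi> (f', t')"
      then have f: "f \<in> (\<Pi>\<^sub>E i\<in>{..<1}. UNIV)" "f' \<in> (\<Pi>\<^sub>E i\<in>{..<1}. UNIV)"
        by (auto simp: DirProd_def integer_group_def)
      have t: "t \<in> carrier G" "\<theta> t = 0" "t' \<in> carrier G" "\<theta> t' = 0"
        using * by (auto simp: DirProd_def carr)
      have "\<theta> (g [^] f 0 \<otimes> t) = \<theta> (g [^] f' 0 \<otimes> t')" using * by (simp add: \<Phi>_def)
      then have f0: "f 0 = f' 0" using t g d by (simp add: \<theta>_mult \<theta>_pow)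
      then have "f = f'" using f by (auto intro: PiE_ext)
      moreover have "t = t'" using * f0 t g by (simp add: \<Phi>_def)
      ultimately show "f = f' \<and> t = t'" by simp
    qed
    moreover have "\<Phi> ` carrier (?Z \<times>\<times> torsion_subgroup G) = carrier G"
    proof (intro equalityI subsetI)
      fix x assume x: "x \<in> carrier G"
      let ?u = "((\<lambda>i\<in>{..<1::nat}. \<theta> x div int d), x \<otimes> g [^] (- (\<theta> x div int d)))"
      have "?u \<in> carrier (?Z \<times>\<times> torsion_subgroup G)"
        using split[OF x] x g by (auto simp: DirProd_def carr integer_group_def)
      moreover have "\<Phi> ?u = x"
        using x g by (simp add: \<Phi>_def m_lcomm flip: int_pow_mult)
      ultimately show "x \<in> \<Phi> ` carrier (?Z \<times>\<times> torsion_subgroup G)" by (metis imageI)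
    qed (use g in \<open>auto simp: \<Phi>_def DirProd_def carr\<close>)
    ultimately show "bij_betw \<Phi> (carrier (?Z \<times>\<times> torsion_subgroup G)) (carrier G)"
      by (simp add: bij_betw_def)
  qed
  moreover have "group (?Z \<times>\<times> torsion_subgroup G)"
    by (intro DirProd_group torsion_subgroup_group product_group) auto
  ultimately show ?thesis
    unfolding has_rank_def using group.iso_sym by (auto simp: is_iso_def)
qed

text \<open>
  Modulo powers of \<open>P\<close>, squaring the descent relation gives \<open>x\<^sup>2 = (y\<^sup>2)\<^sup>2\<close>. The descent map eventually stays in
  the finite set of elements of height at most \<open>B\<close>, where a repetition yields \<open>z\<^sup>2 = (z\<^sup>2)\<^sup>N\<close> with \<open>N > 1\<close> a
  power of two, so a power of \<open>z\<close> is a power of \<open>P\<close>. This avoids any structure theory of finitely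
  generated abelian groups.
\<close>

lemma (in comm_group) has_rank_1_descent:
  fixes H :: "'a \<Rightarrow> nat" and P T :: 'a and B :: nat
  assumes P: "P \<in> carrier G" and T: "T \<in> carrier G"
    and T2: "\<And>x. x \<in> carrier G \<Longrightarrow> x \<otimes> x = \<one> \<longleftrightarrow> x = \<one> \<or> x = T"
    and T_odd: "\<And>x. x \<in> carrier G \<Longrightarrow> T \<noteq> x \<otimes> x"
    and P_odd: "\<And>x. x \<in> carrier G \<Longrightarrow> P \<noteq> x \<otimes> x" "\<And>x. x \<in> carrier G \<Longrightarrow> T \<otimes> P \<noteq> x \<otimes> x"
    and fin: "\<And>n. finite {x \<in> carrier G. H x \<le> n}"
    and descent: "\<And>x. x \<in> carrier G \<Longrightarrow> \<exists>y\<in>carrier G. \<exists>n::int. \<exists>t\<in>{\<one>, T}.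
          x = P [^] n \<otimes> t \<otimes> (y \<otimes> y) \<and> H y ^ 2 \<le> B * H x"
  shows "has_rank G 1"
proof -
  \<comment> \<open>Since \<open>T\<close> is not a double, no element has order four: the 2-primary
    torsion is \<open>{\<one>, T}\<close>.\<close>
  have tors2: "x \<in> {\<one>, T}" if "x \<in> carrier G" "x [^] (2 ^ k :: nat) = \<one>" for x k
    using that
  proof (induction k arbitrary: x)
    case (Suc k)
    have "(x [^] (2::nat)) [^] (2 ^ k :: nat) = \<one>"
      using Suc.prems by (simp add: nat_pow_pow)
    then have "(x \<otimes> x) [^] (2 ^ k :: nat) = \<one>"
      using Suc.prems(1) by (simp add: numeral_2_eq_2)
    then have "x \<otimes> x \<in> {\<one>, T}" using Suc by simp
    then have "x \<otimes> x = \<one>" using T_odd Suc.prems(1) by auto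
    then show ?case using T2 Suc.prems(1) by auto
  qed simp
  have inf_nat: "n = 0" if "P [^] n = \<one>" for n :: nat
  proof (rule ccontr)
    assume "n \<noteq> 0"
    then obtain m where n: "n = 2 ^ multiplicity 2 n * m" "odd m"
      using multiplicity_decompose'[of n 2] by auto
    define k where "k = multiplicity 2 n"
    note n = n[folded k_def]
    then obtain j where m: "m = 2 * j + 1" by (elim oddE)
    have "(P [^] m) [^] (2 ^ k :: nat) = \<one>"
      using that n P by (simp add: nat_pow_pow mult.commute)
    then have "P [^] m \<in> {\<one>, T}" using tors2 P by blast
    \<comment> \<open>The odd exponent \<open>m\<close> becomes even after one more factor
      \<open>P\<close>, so \<open>P [^] m\<close> being \<open>\<one>\<close> or \<open>T\<close>
      would make \<open>P\<close> or \<open>T \<otimes> P\<close> a square.\<close>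
    moreover have "P [^] m \<otimes> P = P [^] (j + 1) \<otimes> P [^] (j + 1)"
      using P m by (simp only: nat_pow_mult flip: nat_pow_Suc) (simp add: mult_2)
    ultimately show False
      using P_odd P by auto
  qed
  have inf: "n = 0" if "P [^] n = \<one>" for n :: int
  proof -
    have "P [^] nat \<bar>n\<bar> = \<one>"
      using that P by (cases n rule: int_cases3) (auto simp: int_pow_int int_pow_neg)
    then show ?thesis using inf_nat by fastforce
  qed
  define U where "U = range (\<lambda>n::int. P [^] n)"
  have U1: "P [^] n \<in> U" for n :: int by (simp add: U_def)
  interpret U: subgroup U G
  proof (rule subgroupI)
    fix a b assume "a \<in> U" "b \<in> U"
    then show "a \<otimes> b \<in> U" using P by (auto simp: U_def simp flip: int_pow_mult)
    from \<open>a \<in> U\<close> obtain n :: int where "a = P [^] n" by (auto simp: U_def)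
    then have "inv a = P [^] (- n)" using P by (simp add: int_pow_neg)
    then show "inv a \<in> U" using U1 by simp
  qed (use P in \<open>auto simp: U_def\<close>)
  have U_pow: "a [^] n \<in> U" if "a \<in> U" for a and n :: nat
    using that by (induction n) auto
  have U_cancel: "b \<in> U" if "a \<in> U" "a \<otimes> b \<in> U" "b \<in> carrier G" for a b
  proof -
    have "inv a \<otimes> (a \<otimes> b) \<in> U" using that by blast
    then show ?thesis using that U.mem_carrier by (simp flip: m_assoc)
  qed
  from descent have "\<forall>x\<in>carrier G. \<exists>y. y \<in> carrier G \<and> (\<exists>n::int. \<exists>t\<in>{\<one>, T}.
          x = P [^] n \<otimes> t \<otimes> (y \<otimes> y)) \<and> H y ^ 2 \<le> B * H x" by blast
  then obtain s where s: "\<And>x. x \<in> carrier G \<Longrightarrow> s x \<in> carrier G"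
    "\<And>x. x \<in> carrier G \<Longrightarrow> \<exists>n::int. \<exists>t\<in>{\<one>, T}. x = P [^] n \<otimes> t \<otimes> (s x \<otimes> s x)"
    "\<And>x. x \<in> carrier G \<Longrightarrow> H (s x) ^ 2 \<le> B * H x" by metis
  have sq: "\<exists>a\<in>U. x \<otimes> x = a \<otimes> (s x \<otimes> s x) [^] (2::nat)" if x: "x \<in> carrier G" for x
  proof -
    obtain n :: int and t where t: "t \<in> {\<one>, T}" "x = P [^] n \<otimes> t \<otimes> (s x \<otimes> s x)"
      using s(2)[OF x] by blast
    then have t2: "t \<in> carrier G" "t \<otimes> t = \<one>" using T T2 by auto
    have "x \<otimes> x = (P [^] n \<otimes> P [^] n) \<otimes> (t \<otimes> t) \<otimes> (s x \<otimes> s x) [^] (2::nat)"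
      using t2(1) s(1)[OF x] P by (subst (1 2) t(2)) (simp add: numeral_2_eq_2 m_ac)
    then show ?thesis using t2 U1 P s(1)[OF x] by (metis U.m_closed int_pow_closed m_closed r_one)
  qed
  have pow_sq: "(a \<otimes> b [^] m) [^] n = a [^] n \<otimes> (b [^] n) [^] m"
    if "a \<in> carrier G" "b \<in> carrier G" for a b and m n :: nat
  proof -
    have "(a \<otimes> b [^] m) [^] n = a [^] n \<otimes> (b [^] m) [^] n"
      using that by (intro pow_mult_distrib m_comm) auto
    then show ?thesis using that by (simp add: nat_pow_pow mult.commute)
  qed
  have sq_pow: "(x \<otimes> x) [^] n = x [^] (2 * n)" if "x \<in> carrier G" for x and n :: nat
  proof -
    have "x [^] (2 * n) = (x [^] (2::nat)) [^] n" using that by (simp add: nat_pow_pow)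
    then show ?thesis using that by (simp add: numeral_2_eq_2)
  qed
  define F where "F = {x \<in> carrier G. H x \<le> B}"
  have F: "s x \<in> F" if "x \<in> F" for x
  proof -
    have "H (s x) ^ 2 \<le> B * B"
      using s(3)[of x] that by (auto simp: F_def intro: order_trans)
    then show ?thesis using that s(1) by (auto simp: F_def power2_eq_square intro: power2_le_imp_le)
  qed
  have iter: "(s ^^ i) x \<in> carrier G \<and> (\<exists>a\<in>U. x \<otimes> x = a \<otimes> ((s ^^ i) x \<otimes> (s ^^ i) x) [^] (2 ^ i :: nat))"
    if x: "x \<in> carrier G" for x i
  proof (induction i)
    case 0
    then show ?case using x by (auto intro!: bexI[of _ \<one>])
  next
    case (Suc i)
    let ?y = "(s ^^ i) x"
    from Suc obtain a where a: "?y \<in> carrier G" "a \<in> U" "x \<otimes> x = a \<otimes> (?y \<otimes> ?y) [^] (2 ^ i :: nat)"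
      by blast
    obtain b where b: "b \<in> U" "?y \<otimes> ?y = b \<otimes> (s ?y \<otimes> s ?y) [^] (2::nat)"
      using sq[OF a(1)] by blast
    have "x \<otimes> x = a \<otimes> b [^] (2 ^ i :: nat) \<otimes> (s ?y \<otimes> s ?y) [^] (2 ^ Suc i :: nat)"
      unfolding a(3) b(2) using a b s(1)[OF a(1)] U.mem_carrier
      by (simp add: pow_mult_distrib m_comm nat_pow_pow m_assoc)
    then show ?case using a b U_pow s(1) by auto
  qed
  have F_tors: "\<exists>k::nat. k > 0 \<and> x [^] k \<in> U" if x: "x \<in> F" for x
  proof -
    have xc: "x \<in> carrier G" using x by (simp add: F_def)
    have "(s ^^ i) x \<in> F" for i by (induction i) (use x F in auto)
    then have "finite (range (\<lambda>i. (s ^^ i) x))"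
      using fin[of B] by (auto simp: F_def intro: finite_subset[rotated])
    then have "\<not> inj (\<lambda>i. (s ^^ i) x)" using finite_imageD infinite_UNIV_nat by blast
    then obtain i j where ij: "i < j" "(s ^^ i) x = (s ^^ j) x"
      unfolding inj_def by (metis linorder_neq_iff)
    define z where "z = (s ^^ i) x"
    define k :: nat where "k = 2 ^ (j - i) - 1"
    have "(2::nat) ^ 1 \<le> 2 ^ (j - i)" using ij by (intro power_increasing) auto
    then have k: "k > 0" "(2::nat) ^ (j - i) = Suc k" by (auto simp: k_def)
    have zc: "z \<in> carrier G" using iter[OF xc] by (simp add: z_def)
    have "(s ^^ (j - i)) z = (s ^^ (j - i + i)) x" by (simp add: z_def funpow_add)
    also have "\<dots> = z" using ij by (simp add: z_def)
    finally have "(s ^^ (j - i)) z = z" .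
    then obtain a where a: "a \<in> U" "z \<otimes> z = a \<otimes> (z \<otimes> z) [^] Suc k"
      using iter[OF zc, of "j - i"] k by auto
    have "(z \<otimes> z) = (a \<otimes> (z \<otimes> z) [^] k) \<otimes> (z \<otimes> z)"
      by (subst a(2)) (use a(1) zc U.mem_carrier in \<open>simp add: m_assoc\<close>)
    then have "a \<otimes> (z \<otimes> z) [^] k = \<one>"
      by (subst (asm) r_cancel_one') (use a(1) zc U.mem_carrier in simp_all)
    then have zk: "(z \<otimes> z) [^] k \<in> U" using U_cancel[OF a(1), of "(z \<otimes> z) [^] k"] zc by simp
    obtain b where b: "b \<in> U" "x \<otimes> x = b \<otimes> (z \<otimes> z) [^] (2 ^ i :: nat)"
      using iter[OF xc, of i] by (auto simp: z_def)
    have "(x \<otimes> x) [^] k = b [^] k \<otimes> ((z \<otimes> z) [^] k) [^] (2 ^ i :: nat)"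
      unfolding b(2) using pow_sq[OF U.mem_carrier[OF b(1)] m_closed[OF zc zc]] .
    then have "(x \<otimes> x) [^] k \<in> U" using zk b(1) U_pow by simp
    then show ?thesis
      using k by (intro exI[of _ "2 * k"]) (simp add: sq_pow[OF xc])
  qed
  then obtain K where K: "\<And>x. x \<in> F \<Longrightarrow> K x > (0::nat)" "\<And>x. x \<in> F \<Longrightarrow> x [^] K x \<in> U" by metis
  \<comment> \<open>A common multiple of the finitely many exponents; the exponent used for all
    elements is \<open>2 * M\<close>, because the descent relation is available only for
    \<open>x \<otimes> x\<close>.\<close>
  define M where "M = prod K F"
  have finF: "finite F" using fin by (simp add: F_def)
  have "M > 0" using K finF by (auto simp: M_def intro: prod_pos)
  have FM: "x [^] M \<in> U" if "x \<in> F" for x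
  proof -
    have "M = K x * prod K (F - {x})" using that finF by (simp add: M_def prod.remove)
    then have "x [^] M = (x [^] K x) [^] prod K (F - {x})"
      using that by (simp add: nat_pow_pow F_def)
    then show ?thesis using K(2)[OF that] U_pow by simp
  qed
  have "x [^] (2 * M) \<in> U" if "x \<in> carrier G" for x
    using that
  proof (induction "H x" arbitrary: x rule: less_induct)
    case less
    note x = less.prems
    show ?case
    proof (cases "H x \<le> B")
      case True
      then have "(x [^] M) [^] (2::nat) \<in> U" using FM U_pow x by (simp add: F_def)
      then show ?thesis using x by (simp add: nat_pow_pow mult.commute)
    next
      case False
      \<comment> \<open>Above the bound \<open>B\<close> the descent map strictly lowers the height,
        so the induction ends in \<open>F\<close>.\<close>
      have "H (s x) ^ 2 \<le> B * H x" using s(3) x by simp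
      also have "\<dots> < H x ^ 2" using False by (simp add: power2_eq_square)
      finally have "H (s x) < H x" by (rule power_less_imp_less_base) simp
      then have "s x [^] (2 * M) \<in> U" using less s(1) by simp
      then have y: "(s x \<otimes> s x) [^] M \<in> U"
        by (simp add: sq_pow[OF s(1)[OF x]])
      obtain a where a: "a \<in> U" "x \<otimes> x = a \<otimes> (s x \<otimes> s x) [^] (2::nat)"
        using sq[OF x] by blast
      have "x [^] (2 * M) = (x \<otimes> x) [^] M"
        by (simp add: sq_pow[OF x])
      also have "\<dots> = a [^] M \<otimes> ((s x \<otimes> s x) [^] M) [^] (2::nat)"
        unfolding a(2) using pow_sq[OF U.mem_carrier[OF a(1)] m_closed[OF s(1)[OF x] s(1)[OF x]]] .
      finally show ?thesis using a y U_pow by simp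
    qed
  qed
  then show ?thesis
    using \<open>M > 0\<close> P inf by (intro has_rank_1I[of P "2 * M"]) (auto simp: U_def)
qed

section \<open>Halving points\<close>

text \<open>
  The numbers \<open>2 (u\<^sup>2 + w)\<close> and \<open>2 (u\<^sup>2 - w)\<close> are the abscissas of the two preimages of \<open>(u\<^sup>2, u w)\<close> under
  the 2-isogeny from \<open>y\<^sup>2 = x\<^sup>3 - 4 a x\<close>.
\<close>

lemma ec_halving:
  fixes u v w a :: "'a::field_char_0"
  assumes E: "elliptic_curve a 0" and w: "w ^ 2 = u ^ 4 + a" and v: "2 * (u ^ 2 + w) = v ^ 2"
  defines "R \<equiv> Affine (v * (v + 2 * u) / 2) (v * (v * (v + 2 * u) / 2))"
  shows "R \<in> ec_points a 0" "ec_add a R R = Affine (u ^ 2) (u * w)"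
proof -
  \<comment> \<open>\<open>R\<close> lies on the line through the origin of slope \<open>v\<close>,
    so its abscissa is a root of \<open>x ^ 2 - v ^ 2 * x + a\<close>; by the assumptions on
    \<open>w\<close> and \<open>v\<close> the discriminant is \<open>(2 * u * v) ^ 2\<close>. The
    tangent at \<open>R\<close> has slope \<open>u + v\<close>.\<close>
  define x where "x = v * (v + 2 * u) / 2"
  have x: "2 * x = v * (v + 2 * u)" by (simp add: x_def)
  have line: "ec_line a 0 (u + v) (- u * x) x x (u ^ 2)"
    unfolding ec_line_def
  proof (intro conjI)
    show "x + x + u ^ 2 = (u + v) ^ 2" using x by Groebner_Basis.algebra
    show "x * x + x * u ^ 2 + x * u ^ 2 = a - 2 * (u + v) * (- u * x)"
    proof -
      have "4 * (x * x + x * u ^ 2 + x * u ^ 2) = 4 * (a - 2 * (u + v) * (- u * x))"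
        using x w v by Groebner_Basis.algebra
      then show ?thesis by (simp only: mult_cancel_left) simp
    qed
    show "x * x * u ^ 2 = (- u * x) ^ 2 - 0" by Groebner_Basis.algebra
  qed
  have y: "(u + v) * x + - u * x = v * x" "- ((u + v) * u ^ 2 + - u * x) = u * w"
  proof -
    have "2 * (- ((u + v) * u ^ 2 + - u * x)) = 2 * (u * w)" using x v by Groebner_Basis.algebra
    then show "- ((u + v) * u ^ 2 + - u * x) = u * w" by (simp only: mult_cancel_left) simp
  qed (simp add: algebra_simps)
  have R: "R = Affine x ((u + v) * x + - u * x)"
    by (simp only: R_def y(1)) (simp add: x_def)
  show "R \<in> ec_points a 0"
    unfolding R by (rule ec_line_points(1)[OF line])
  show "ec_add a R R = Affine (u ^ 2) (u * w)"
    unfolding R ec_line_collinear(1)[OF E line] ec_neg.simps y(2) ..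
qed

text \<open>
  The formulas for \<open>u'\<close> and \<open>w'\<close> come from adding the preimages under the isogeny, where the product of
  the abscissas of three collinear points is a square.
\<close>

lemma ec_square_coset_add:
  fixes u u0 w w0 \<tau> a :: "'a::field_char_0"
  assumes E: "elliptic_curve a 0" and w: "w ^ 2 = u ^ 4 + a" and w0: "w0 ^ 2 = u0 ^ 4 + a"
    and \<tau>: "u ^ 2 + w = (u0 ^ 2 + w0) * \<tau> ^ 2" and nz: "u0 ^ 2 + w0 \<noteq> 0" and ne: "u ^ 2 \<noteq> u0 ^ 2"
  obtains u' v' w' where "w' ^ 2 = u' ^ 4 + a" "2 * (u' ^ 2 + w') = v' ^ 2"
    "ec_add a (Affine (u ^ 2) (u * w)) (Affine (u0 ^ 2) (u0 * w0)) = Affine (u' ^ 2) (u' * w')"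
proof -
  have une: "u - u0 \<noteq> 0" using ne by auto
  define z where "z = u ^ 2 + w"
  define z0 where "z0 = u0 ^ 2 + w0"
  have zne: "z - z0 \<noteq> 0"
  proof
    assume "z - z0 = 0"
    then have "z0 * (u ^ 2 - u0 ^ 2) = 0"
      using w w0 unfolding z_def z0_def by Groebner_Basis.algebra
    then show False using ne nz by (simp add: z0_def)
  qed
  \<comment> \<open>The preimages under the isogeny have abscissas \<open>2 * z\<close> and
    \<open>2 * z0\<close>, and \<open>2 * u\<close> and \<open>2 * u0\<close> are their quotients of
    ordinate by abscissa. \<open>r\<close> is the slope of the chord through
    \<open>(2 * u, z)\<close> and \<open>(2 * u0, z0)\<close>, and \<open>\<sigma>\<close> is chosen
    to make \<open>z\<close> and \<open>z0\<close> multiples of \<open>2 * r\<close>.\<close>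
  define r where "r = (z - z0) / (2 * (u - u0))"
  define \<sigma> where "\<sigma> = z0 / (2 * r)"
  have r: "z - z0 = 2 * r * (u - u0)" "r \<noteq> 0" using une zne
    by (simp_all only: r_def nonzero_mult_div_cancel_left mult_eq_0_iff divide_eq_0_iff) (simp_all add: field_simps)
  have \<sigma>: "z0 = 2 * \<sigma> * r" using r(2) by (simp add: \<sigma>_def)
  have "(u - u0) * r * (r * (2 * \<sigma> + u - u0)) = (u - u0) * r * (u ^ 2 + \<sigma> * (u + u0))"
    using w w0 r(1) \<sigma> unfolding z_def z0_def by Groebner_Basis.algebra
  then have rel: "r * (2 * \<sigma> + u - u0) = u ^ 2 + \<sigma> * (u + u0)" using une r(2) by simp
  define u' where "u' = r - u - \<sigma>"
  define w' where "w' = 2 * \<sigma> * (\<sigma> + u - u0) - u' ^ 2"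
  define m where "m = \<sigma> - u0 + r"
  define c where "c = u0 * w0 - m * u0 ^ 2"
  have w_eq: "w = 2 * r * (\<sigma> + u - u0) - u ^ 2" "w0 = 2 * \<sigma> * r - u0 ^ 2"
    using r(1) \<sigma> unfolding z_def z0_def by Groebner_Basis.algebra+
  have a: "a = 4 * \<sigma> ^ 2 * r ^ 2 - 4 * u0 ^ 2 * \<sigma> * r"
    using w0 w_eq(2) by Groebner_Basis.algebra
  have line: "ec_line a 0 m c (u ^ 2) (u0 ^ 2) (u' ^ 2)"
    unfolding ec_line_def
  proof (intro conjI)
    show "u ^ 2 + u0 ^ 2 + u' ^ 2 = m ^ 2"
      using rel unfolding u'_def m_def by Groebner_Basis.algebra
    show "u ^ 2 * u0 ^ 2 + u ^ 2 * u' ^ 2 + u0 ^ 2 * u' ^ 2 = a - 2 * m * c"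
      using rel w_eq(2) a unfolding u'_def m_def c_def by Groebner_Basis.algebra
    show "u ^ 2 * u0 ^ 2 * u' ^ 2 = c ^ 2 - 0"
      using rel w_eq(2) unfolding u'_def m_def c_def by Groebner_Basis.algebra
  qed
  have y: "m * u ^ 2 + c = u * w" "- (m * u' ^ 2 + c) = u' * w'" "m * u0 ^ 2 + c = u0 * w0"
  proof -
    show "m * u ^ 2 + c = u * w"
      using rel w_eq unfolding m_def c_def by Groebner_Basis.algebra
    show "- (m * u' ^ 2 + c) = u' * w'"
      using rel w_eq unfolding w'_def u'_def m_def c_def by Groebner_Basis.algebra
    show "m * u0 ^ 2 + c = u0 * w0" by (simp add: c_def)
  qed
  have "w' ^ 2 = u' ^ 4 + a"
    using rel a unfolding w'_def u'_def by Groebner_Basis.algebra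
  moreover have "2 * (u' ^ 2 + w') = (2 * \<sigma> * \<tau>) ^ 2"
  proof -
    \<comment> \<open>Up to the square factor \<open>r ^ 2\<close>, the new abscissa is the product
      \<open>z * z0\<close>, which is a square because \<open>z = z0 * \<tau> ^ 2\<close>.\<close>
    have "r * (2 * (u' ^ 2 + w')) = r * (2 * \<sigma> * \<tau>) ^ 2"
      using \<tau> w_eq unfolding w'_def by Groebner_Basis.algebra
    then show ?thesis using r(2) by simp
  qed
  moreover have "ec_add a (Affine (u ^ 2) (u * w)) (Affine (u0 ^ 2) (u0 * w0)) = Affine (u' ^ 2) (u' * w')"
    using ec_line_collinear(1)[OF E line] unfolding y(1,3) ec_neg.simps y(2) .
  ultimately show ?thesis by (rule that)
qed

lemma ec_double:
  assumes E: "elliptic_curve a 0" and R: "y ^ 2 = x ^ 3 + a * x" and y: "y \<noteq> 0"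
  obtains Y where "ec_add a (Affine x y) (Affine x y) = Affine ((x ^ 2 - a) ^ 2 / (4 * y ^ 2)) Y"
proof -
  have "\<not> (x = x \<and> y = - y)" using y eq_neg_self_iff by blast
  moreover have R': "y ^ 2 = x ^ 3 + a * x + 0" using R by simp
  ultimately obtain m c z where l: "ec_line a 0 m c x x z" "y = m * x + c"
    using ec_line_exists by metis
  have "z * (4 * y ^ 2) = (x ^ 2 - a) ^ 2"
    using ec_line_derivative[OF l(1)] l R unfolding ec_line_def by Groebner_Basis.algebra
  then have "z = (x ^ 2 - a) ^ 2 / (4 * y ^ 2)" using y by (simp add: eq_divide_eq)
  then show ?thesis
    using ec_line_collinear(1)[OF E l(1)] that l(2) by (metis ec_neg.simps(2))
qed

lemma ec_add_origin:
  assumes E: "elliptic_curve a 0" and R: "y ^ 2 = x ^ 3 + a * x" and x: "x \<noteq> 0"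
  shows "ec_add a (Affine x y) (Affine 0 0) = Affine (a / x) (- (a * y / x ^ 2))"
proof -
  have "ec_line a 0 (y / x) 0 x 0 (a / x)"
    using x R by (auto simp: ec_line_def field_simps power2_eq_square power3_eq_cube)
  from ec_line_collinear(1)[OF E this] show ?thesis
    using x by (simp add: power2_eq_square mult.commute)
qed

section \<open>Two-descent\<close>

lemma QuadRes_cancel_square:
  assumes "prime r" "\<not> r dvd m" "[N ^ 2 = d * m ^ 2] (mod r)"
  shows "QuadRes r d"
proof -
  have "coprime m r" using assms(1,2) by (metis coprime_commute prime_imp_coprime)
  then obtain s where s: "[m * s = 1] (mod r)" using cong_solve_coprime_int by blast
  have "[(N * s) ^ 2 = (d * m ^ 2) * s ^ 2] (mod r)"
    unfolding power_mult_distrib using assms(3) by (rule cong_scalar_right)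
  also have "(d * m ^ 2) * s ^ 2 = d * (m * s) ^ 2" by (simp add: power_mult_distrib)
  also have "[d * (m * s) ^ 2 = d * 1 ^ 2] (mod r)"
    using s by (intro cong_scalar_left cong_pow)
  finally show ?thesis by (auto simp: QuadRes_def)
qed

lemma QuadRes_mult: "QuadRes r a \<Longrightarrow> QuadRes r b \<Longrightarrow> QuadRes r (a * b)"
  unfolding QuadRes_def by (metis cong_mult power_mult_distrib)

lemma QuadRes_minus_one_iff:
  assumes "prime r" "(r::int) > 2"
  shows "QuadRes r (- 1) \<longleftrightarrow> r mod 4 = 1"
proof -
  have np: "prime (nat r)" "2 < nat r" "int (nat r) = r" using assms by auto
  have L: "[Legendre (- 1) r = (- 1) ^ ((nat r - 1) div 2)] (mod r)"
    using euler_criterion[OF np(1,2), of "- 1"] np(3) by simp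
  have ne: "\<not> [1 = - 1] (mod r)" "\<not> [- 1 = 1] (mod r)" "\<not> [- 1 = 0] (mod r)"
    using assms(2) zdvd_not_zless[of 2 r] zdvd_not_zless[of 1 r] by (auto simp: cong_iff_dvd_diff)
  have "odd r" using assms prime_odd_int by blast
  then have r4: "r mod 4 = 1 \<or> r mod 4 = 3" by presburger
  have even: "even ((n - 1) div 2)" if "n mod 4 = 1" for n :: nat using that by presburger
  have odd: "odd ((n - 1) div 2)" if "n mod 4 = 3" for n :: nat using that by presburger
  from r4 show ?thesis
  proof
    assume r: "r mod 4 = 1"
    then have "int (nat r mod 4) = int 1" using np(3) by (simp add: zmod_int)
    then have "nat r mod 4 = 1" by (simp only: of_nat_eq_iff)
    then have "even ((nat r - 1) div 2)" by (rule even)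
    then have "[Legendre (- 1) r = 1] (mod r)" using L by simp
    then have "QuadRes r (- 1)" using ne by (auto simp: Legendre_def split: if_splits)
    then show ?thesis using r by simp
  next
    assume r: "r mod 4 = 3"
    then have "int (nat r mod 4) = int 3" using np(3) by (simp add: zmod_int)
    then have "nat r mod 4 = 3" by (simp only: of_nat_eq_iff)
    then have "odd ((nat r - 1) div 2)" by (rule odd)
    then have "[Legendre (- 1) r = - 1] (mod r)" using L by simp
    then have "\<not> QuadRes r (- 1)" using ne by (auto simp: Legendre_def split: if_splits)
    then show ?thesis using r by simp
  qed
qed

lemma QuadRes_5: "QuadRes 5 a \<Longrightarrow> a mod 5 \<in> {0, 1, 4}"
proof -
  assume "QuadRes 5 a"
  then obtain y where "[y ^ 2 = a] (mod 5)" by (auto simp: QuadRes_def)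
  then have "a mod 5 = (y mod 5) ^ 2 mod 5" by (simp add: cong_def power_mod)
  moreover have "y mod 5 \<in> {0, 1, 2, 3, 4}" by auto
  ultimately show ?thesis by auto
qed

text \<open>As 5 is 1 modulo 4, reciprocity carries no sign, and the question moves to the
  nonresidues 2 and 3 modulo 5.\<close>

lemma QuadRes_5_right:
  assumes "prime r" "(r::int) > 5" "r mod 5 \<in> {2, 3}"
  shows "\<not> QuadRes r 5"
proof -
  have "Legendre r 5 * Legendre 5 r = (- 1) ^ nat ((r - 1) div 2 * ((5 - 1) div 2))"
    using assms by (intro Quadratic_Reciprocity_int) auto
  also have "nat ((r - 1) div 2 * ((5 - 1) div 2)) = 2 * nat ((r - 1) div 2)"
    by (simp add: nat_mult_distrib)
  finally have "Legendre r 5 * Legendre 5 r = 1" by (simp add: power_mult)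
  moreover have "Legendre r 5 = - 1"
    using assms(3) QuadRes_5[of r] by (auto simp: Legendre_def cong_def)
  ultimately show ?thesis by (auto simp: Legendre_def split: if_splits)
qed

text \<open>Modulo \<open>r\<close> the equation makes \<open>d\<close> a square unless
  \<open>r\<close> divides \<open>M\<close>. In that case \<open>r ^ 2\<close> divides
  \<open>N ^ 2\<close> and \<open>M ^ 4\<close>, hence also \<open>b\<close>, since \<open>e\<close>
  is prime to \<open>M\<close>.\<close>

lemma quartic_not_QuadRes_left:
  fixes r d b M e N :: int
  assumes r: "prime r" "\<not> QuadRes r d" "r dvd b" "\<not> r ^ 2 dvd b"
    and eq: "N ^ 2 = d * M ^ 4 + b * e ^ 4" and cop: "coprime M e"
  shows False
proof (cases "r dvd M")
  case True
  then have "\<not> r dvd e" using cop r(1) by (meson coprime_common_divisor not_prime_unit)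
  then have re: "coprime (r ^ 2) (e ^ 4)" using r(1) by (simp add: prime_imp_coprime)
  obtain k where k: "M = r * k" using True by blast
  have "r dvd N ^ 2" using r(3) unfolding eq k by (simp add: power_mult_distrib)
  then have "r dvd N" using r(1) prime_dvd_power by blast
  then have "r ^ 2 dvd N ^ 2" by simp
  moreover have "r ^ 2 dvd M ^ 4"
    unfolding k power_mult_distrib by (intro dvd_mult2 le_imp_power_dvd) simp
  ultimately have "r ^ 2 dvd b * e ^ 4" using eq by (simp add: dvd_add_right_iff)
  then show False using re r(4) coprime_dvd_mult_left_iff by blast
next
  case False
  have "[N ^ 2 = d * (M ^ 2) ^ 2] (mod r)"
    using eq r(3) by (simp add: cong_iff_dvd_diff dvd_mult2)
  moreover have "\<not> r dvd M ^ 2" using False r(1) prime_dvd_power by blast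
  ultimately show False using QuadRes_cancel_square r by blast
qed

lemma quartic_not_QuadRes_right:
  fixes r d b M e N :: int
  assumes r: "prime r" "\<not> QuadRes r b" "r dvd d"
    and eq: "N ^ 2 = d * M ^ 4 + b * e ^ 4" and cop: "coprime d e"
  shows False
proof -
  have "\<not> r dvd e" using cop r by (meson coprime_common_divisor not_prime_unit)
  then have "\<not> r dvd e ^ 2" using r(1) prime_dvd_power by blast
  moreover have "[N ^ 2 = b * (e ^ 2) ^ 2] (mod r)"
    using eq r(3) by (simp add: cong_iff_dvd_diff dvd_mult2)
  ultimately show False using QuadRes_cancel_square r by blast
qed

lemma quartic_QuadRes:
  fixes r d b M e N :: int
  assumes "prime r" "r dvd d * b" "\<not> r ^ 2 dvd d * b"
    and "N ^ 2 = d * M ^ 4 + b * e ^ 4" "coprime (d * M) e"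
  shows "if r dvd d then QuadRes r b else QuadRes r d"
proof (cases "r dvd d")
  case True
  moreover have "coprime d e" using assms(5) by simp
  ultimately show ?thesis using quartic_not_QuadRes_right[OF assms(1) _ True assms(4)] by auto
next
  case False
  then have "r dvd b" using assms(1,2) by (simp add: prime_dvd_mult_iff)
  moreover have "\<not> r ^ 2 dvd b" using assms(3) by auto
  moreover have "coprime M e" using assms(5) by simp
  ultimately show ?thesis using quartic_not_QuadRes_left[OF assms(1) _ _ _ assms(4)] False by auto
qed

section \<open>From rational points to quartics over the integers\<close>

lemma rat_square_int:
  fixes x :: rat
  assumes "x ^ 2 = of_int k"
  obtains j :: int where "x = of_int j"
proof -
  obtain a c where q: "quotient_of x = (a, c)" by force
  note c = quotient_of_denom_pos[OF q] quotient_of_coprime[OF q] quotient_of_div[OF q]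
  have "of_int (a ^ 2) = (of_int (k * c ^ 2) :: rat)"
    using assms c(1) unfolding c(3) by (simp add: field_simps power_divide)
  then have "a ^ 2 = k * c ^ 2" by (simp only: of_int_eq_iff)
  then have "c ^ 2 dvd a ^ 2" by simp
  then have "c dvd a" by simp
  then have "c = 1" using c(1,2) by (metis coprime_common_divisor dvd_refl zdvd1_eq abs_of_pos)
  then show ?thesis using c(3) that by simp
qed

lemma coprime_mult_eq_square_int:
  fixes a b c :: int
  assumes "coprime a b" "a > 0" "a * b = c ^ 2"
  obtains e where "a = e ^ 2"
proof (cases "b = 0")
  case True
  then have "a = 1 ^ 2" using assms(1,2) by simp
  then show ?thesis by (rule that)
next
  case False
  have "nat \<bar>a\<bar> * nat \<bar>b\<bar> = (nat \<bar>c\<bar>) ^ 2"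
    using assms(3) by (metis abs_mult nat_abs_mult_distrib nat_power_eq abs_ge_zero power_abs)
  moreover have "coprime (nat \<bar>a\<bar>) (nat \<bar>b\<bar>)" using assms(1) by simp
  ultimately have "is_nth_power 2 (nat \<bar>a\<bar>)"
    using is_nth_power_mult_coprime_natD(1)[of "nat \<bar>a\<bar>" "nat \<bar>b\<bar>" 2] assms(2) False by simp
  then obtain e where "nat \<bar>a\<bar> = e ^ 2" by (elim is_nth_powerE)
  then have "a = int e ^ 2" using assms(2) by (metis abs_of_pos int_nat_eq of_nat_power order_less_imp_le)
  then show ?thesis by (rule that)
qed

lemma squarefree_dvd_square:
  fixes d z :: int
  assumes "squarefree d" "d dvd z ^ 2"
  shows "d dvd z"
proof (cases "z = 0")
  case False
  define g where "g = gcd d z"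
  obtain h z' where h: "d = g * h" "z = g * z'" "coprime h z'"
    using gcd_coprime_exists[of d z] False by (metis g_def gcd_eq_0_iff mult.commute)
  have "g \<noteq> 0" using False by (simp add: g_def)
  then have "h dvd g * z' ^ 2"
    using assms(2) unfolding h(1,2) by (simp add: power2_eq_square mult_ac)
  then have "h dvd g" using h(3) by (simp add: coprime_dvd_mult_left_iff)
  then have "h ^ 2 dvd d" unfolding h(1) power2_eq_square by simp
  then have "is_unit h" using assms(1) squarefreeD by blast
  then have "d dvd g" using h(1) by (metis dvd_mult_unit_iff dvd_refl mult.commute)
  then show ?thesis unfolding g_def using gcd_dvd2 dvd_trans by blast
qed simp

text \<open>The denominator of \<open>x\<close> is a square, and the squarefree part
  \<open>d\<close> of the numerator, which carries its sign, divides \<open>b\<close> because it is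
  prime to the denominator. The quartic is the homogeneous space attached to \<open>d\<close>; its
  solvability modulo primes restricts the square class of \<open>x\<close>.\<close>

lemma two_descent:
  fixes b :: int and x y :: rat
  assumes b: "b \<noteq> 0" and eq: "y ^ 2 = x ^ 3 + of_int b * x" and x: "x \<noteq> 0"
  obtains d b' M e N :: int where "b = d * b'" "squarefree d" "M \<noteq> 0" "e \<noteq> 0" "coprime (d * M) e"
    "N ^ 2 = d * M ^ 4 + b' * e ^ 4" "x = of_int d * (of_int M / of_int e) ^ 2"
proof -
  obtain m n where q: "quotient_of x = (m, n)" by force
  note n = quotient_of_denom_pos[OF q] quotient_of_coprime[OF q] quotient_of_div[OF q]
  have "(y * of_int n ^ 2) ^ 2 = of_int (n * (m * (m ^ 2 + b * n ^ 2)))"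
    using n(1) unfolding power_mult_distrib eq n(3)
    by (simp add: field_simps power2_eq_square power3_eq_cube)
  moreover obtain Y where "y * of_int n ^ 2 = of_int Y"
    using rat_square_int calculation by blast
  ultimately have "of_int (Y ^ 2) = (of_int (n * (m * (m ^ 2 + b * n ^ 2))) :: rat)"
    by simp
  then have Y: "n * (m * (m ^ 2 + b * n ^ 2)) = Y ^ 2" by (simp only: of_int_eq_iff)
  \<comment> \<open>Modulo \<open>n\<close> this factor is \<open>m ^ 2\<close>, so the positive
    number \<open>n\<close> is prime to its cofactor in the square \<open>Y ^ 2\<close> and is
    itself a square.\<close>
  have "coprime n (m ^ 2 + n * (b * n))"
  proof (rule coprimeI)
    fix c assume "c dvd n" "c dvd m ^ 2 + n * (b * n)"
    then have "c dvd m ^ 2" by (simp add: dvd_add_left_iff)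
    moreover have "coprime n (m ^ 2)" using n(2) by (simp add: coprime_commute)
    ultimately show "is_unit c" using \<open>c dvd n\<close> coprime_common_divisor by blast
  qed
  then have cop: "coprime n (m * (m ^ 2 + b * n ^ 2))"
    using n(2) by (simp add: coprime_commute power2_eq_square mult_ac)
  obtain e where e: "n = e ^ 2" using coprime_mult_eq_square_int[OF cop n(1) Y] .
  have e0: "e \<noteq> 0" using e n(1) by auto
  have "e ^ 2 dvd Y ^ 2" using Y e by (metis dvd_triv_left)
  then obtain Z where Z: "Y = e * Z" by auto
  have "e ^ 2 * (m * (m ^ 2 + b * e ^ 4)) = e ^ 2 * Z ^ 2"
    using Y unfolding e Z by (simp add: power_mult_distrib)
  then have Z2: "m * (m ^ 2 + b * e ^ 4) = Z ^ 2" using e0 by simp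
  define d where "d = squarefree_part m"
  define M where "M = square_part m"
  have m: "m = d * M ^ 2" unfolding d_def M_def by (rule squarefree_decompose)
  have sf: "squarefree d" by (simp add: d_def)
  have M0: "M \<noteq> 0" using x n(3) m by auto
  have d0: "d \<noteq> 0" by (simp add: d_def)
  have "M ^ 2 dvd Z ^ 2" using Z2 m by (metis dvd_mult2 dvd_triv_right)
  then obtain Z1 where Z1: "Z = M * Z1" by auto
  have "M ^ 2 * (d * (d ^ 2 * M ^ 4 + b * e ^ 4)) = M ^ 2 * Z1 ^ 2"
    using Z2 unfolding m Z1 by (simp add: power_mult_distrib mult_ac)
  then have Z1eq: "d * (d ^ 2 * M ^ 4 + b * e ^ 4) = Z1 ^ 2" using M0 by simp
  then have "d dvd Z1" using squarefree_dvd_square[OF sf] by (metis dvd_triv_left)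
  then obtain N where N: "Z1 = d * N" by auto
  have N2: "d ^ 2 * M ^ 4 + b * e ^ 4 = d * N ^ 2"
    using Z1eq d0 unfolding N by (simp add: power2_eq_square)
  have copd: "coprime (d * M) e"
    using n(2) unfolding m e by auto
  have "d dvd b * e ^ 4"
    using N2 by (metis dvd_add_right_iff dvd_mult2 dvd_triv_left power2_eq_square)
  moreover have "coprime d (e ^ 4)" using copd by auto
  ultimately have "d dvd b" by (simp add: coprime_dvd_mult_left_iff)
  then obtain b' where b': "b = d * b'" by auto
  have "d * (N ^ 2) = d * (d * M ^ 4 + b' * e ^ 4)"
    using N2 unfolding b' by (simp add: algebra_simps power2_eq_square)
  then have "N ^ 2 = d * M ^ 4 + b' * e ^ 4" using d0 by simp
  moreover have "x = of_int d * (of_int M / of_int e) ^ 2"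
    unfolding n(3) m e by (simp add: power_divide)
  ultimately show ?thesis using that b' sf M0 e0 copd by blast
qed

lemma dvd_prime_mult_cases:
  fixes d r k :: int
  assumes "prime r" "d dvd r * k"
  obtains "d dvd k" | d' where "d = r * d'" "d' dvd k"
proof (cases "r dvd d")
  case True
  then obtain d' where "d = r * d'" by auto
  then show ?thesis using that(2) assms by auto
next
  case False
  then have "coprime d r" using assms(1) by (metis coprime_commute prime_imp_coprime)
  then show ?thesis using that(1) assms(2) by (simp add: coprime_dvd_mult_right_iff)
qed

section \<open>Residue conditions at 5, p and q\<close>

locale descent_primes =
  fixes p q s :: int
  assumes p: "prime p" and q: "prime q" and p40: "p mod 40 = 33" and q40: "q mod 40 = 27"
    and s: "p + 5 * q = 8 * s ^ 2"
begin

lemma pq_pos: "p > 5" "q > 5" "p \<noteq> q"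
proof -
  have "p > 0" "q > 0" using p q prime_gt_0_int by auto
  then show "p > 5" "q > 5" "p \<noteq> q"
    using p40 q40 by presburger+
qed

lemma pq_mod: "p mod 5 = 3" "q mod 5 = 2" "p mod 4 = 1" "q mod 4 = 3" "(- p) mod 5 = 2" "(- q) mod 5 = 3"
proof -
  show p5: "p mod 5 = 3" and "p mod 4 = 1" using p40 by presburger+
  show q5: "q mod 5 = 2" and "q mod 4 = 3" using q40 by presburger+
  show "(- p) mod 5 = 2" using p5 by presburger
  show "(- q) mod 5 = 3" using q5 by presburger
qed

lemma prime5: "prime (5::int)" by simp

lemma not_dvd: "\<not> p dvd q" "\<not> q dvd p" "\<not> p dvd 5" "\<not> q dvd 5" "\<not> 5 dvd p" "\<not> 5 dvd q"
  "\<not> p dvd 2" "\<not> q dvd 2"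
proof -
  show "\<not> p dvd q" "\<not> q dvd p"
    using primes_dvd_imp_eq[OF p q] primes_dvd_imp_eq[OF q p] pq_pos(3) by blast+
  show "\<not> p dvd 5" "\<not> q dvd 5" "\<not> p dvd 2" "\<not> q dvd 2"
    using pq_pos(1,2) by (simp_all add: zdvd_not_zless)
  show "\<not> 5 dvd p" "\<not> 5 dvd q"
    using pq_mod(1,2) by presburger+
qed

lemma nonresidues:
  "\<not> QuadRes p 5" "\<not> QuadRes p (- 5)" "\<not> QuadRes p 20" "\<not> QuadRes p (2 * q)" "\<not> QuadRes q (- 1)"
proof -
  show 5: "\<not> QuadRes p 5" using QuadRes_5_right[OF p] pq_pos pq_mod by simp
  have "QuadRes p (- 1)" using QuadRes_minus_one_iff[OF p] pq_pos pq_mod by simp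
  then show "\<not> QuadRes p (- 5)" using QuadRes_mult[of p "- 1" "- 5"] 5 by auto
  show "\<not> QuadRes p 20"
  proof
    assume "QuadRes p 20"
    then obtain y where "[y ^ 2 = 5 * 2 ^ 2] (mod p)" by (auto simp: QuadRes_def)
    then show False using QuadRes_cancel_square[OF p] not_dvd 5 by blast
  qed
  show "\<not> QuadRes p (2 * q)"
  proof
    assume "QuadRes p (2 * q)"
    then obtain y where y: "[y ^ 2 = 2 * q] (mod p)" by (auto simp: QuadRes_def)
    \<comment> \<open>Modulo \<open>p\<close>, \<open>5 * q\<close> is \<open>8 * s ^ 2\<close>. So
      if \<open>2 * q\<close> were the square of \<open>y\<close>, then
      \<open>(2 * s * y) ^ 2\<close> would be \<open>5 * q ^ 2\<close>, and 5 would be a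
      residue.\<close>
    have "(2 * s * y) ^ 2 - 5 * q ^ 2 = 4 * s ^ 2 * (y ^ 2 - 2 * q) + p * q"
    proof -
      have "8 * s ^ 2 * q = (p + 5 * q) * q" using s by simp
      then show ?thesis by (simp add: power_mult_distrib algebra_simps power2_eq_square)
    qed
    moreover have "p dvd y ^ 2 - 2 * q" using y by (simp add: cong_iff_dvd_diff)
    ultimately have "p dvd (2 * s * y) ^ 2 - 5 * q ^ 2" by simp
    then show False
      using QuadRes_cancel_square[OF p not_dvd(1)] 5 by (metis cong_iff_dvd_diff)
  qed
  show "\<not> QuadRes q (- 1)" using QuadRes_minus_one_iff[OF q] pq_pos pq_mod by simp
qed

lemma not_QuadRes_5: "a mod 5 = 2 \<or> a mod 5 = 3 \<Longrightarrow> \<not> QuadRes 5 a"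
  using QuadRes_5[of a] by auto

lemma dvd_q:
  assumes "d dvd q"
  shows "d \<in> {1, - 1, q, - q}"
proof -
  from assms have "d dvd q * 1" by simp
  with q show ?thesis
  proof (cases rule: dvd_prime_mult_cases)
    case 2
    then show ?thesis by (simp only: zdvd1_eq) (auto simp: abs_eq_iff')
  qed (auto simp: abs_eq_iff')
qed

lemma dvd_pq:
  assumes "d dvd p * q"
  shows "d \<in> {1, - 1, q, - q, p, - p, p * q, - (p * q)}"
  using p assms
proof (cases rule: dvd_prime_mult_cases)
  case 1
  then show ?thesis using dvd_q by blast
next
  case (2 d')
  then show ?thesis using dvd_q[OF 2(2)] by (elim insertE emptyE) simp_all
qed

lemma dvd_5pq:
  assumes "d dvd 5 * (p * q)"
  shows "d \<in> {1, - 1, q, - q, p, - p, p * q, - (p * q),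
    5, - 5, 5 * q, - (5 * q), 5 * p, - (5 * p), 5 * (p * q), - (5 * (p * q))}"
  using prime5 assms
proof (cases rule: dvd_prime_mult_cases)
  case 1
  then show ?thesis using dvd_pq by blast
next
  case (2 d')
  then show ?thesis using dvd_pq[OF 2(2)] by (elim insertE emptyE) simp_all
qed

lemma dvd_5pq_pos:
  assumes "d dvd 5 * (p * q)" "d > 0"
  shows "d \<in> {1, q, p, p * q, 5, 5 * q, 5 * p, 5 * (p * q)}"
proof -
  have "p > 0" "q > 0" "p * q > 0" using pq_pos by simp_all
  then show ?thesis using dvd_5pq[OF assms(1)] assms(2) by (elim insertE emptyE) simp_all
qed

lemma pq_mod_5: "(p * q) mod 5 = 1"
proof -
  have "(p * q) mod 5 = ((p mod 5) * (q mod 5)) mod 5" by (rule mod_mult_eq[symmetric])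
  then show ?thesis unfolding pq_mod(1,2) by simp
qed

lemma pq_mod_5_multiples: "(2 * (p * q)) mod 5 = 2" "(4 * p) mod 5 = 2" "(4 * q) mod 5 = 3" "\<not> 5 dvd 2 * (p * q)"
proof -
  show "(2 * (p * q)) mod 5 = 2" using mod_mult_right_eq[of 2 "p * q" 5] pq_mod_5 by simp
  then show "\<not> 5 dvd 2 * (p * q)" by auto
  show "(4 * p) mod 5 = 2" "(4 * q) mod 5 = 3" using pq_mod(1,2) by presburger+
qed

lemma not_square_dvd: "\<not> 5 ^ 2 dvd 5 * (p * q)" "\<not> p ^ 2 dvd 5 * (p * q)" "\<not> q ^ 2 dvd 5 * (p * q)"
  "\<not> 5 ^ 2 dvd 20 * (p * q)" "\<not> p ^ 2 dvd 20 * (p * q)"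
proof -
  have *: "\<not> r ^ 2 dvd r * (x * y)" if "prime r" "\<not> r dvd x" "\<not> r dvd y" for r x y :: int
  proof
    assume "r ^ 2 dvd r * (x * y)"
    moreover have "r \<noteq> 0" using that(1) by auto
    ultimately have "r dvd x * y" unfolding power2_eq_square by (simp only: dvd_mult_cancel_left) simp
    then show False using that prime_dvd_mult_iff by blast
  qed
  have "\<not> p dvd 2 * 2" unfolding prime_dvd_mult_iff[OF p] using not_dvd by blast
  then have "\<not> p dvd 4" by simp
  then have "\<not> p dvd 4 * 5" unfolding prime_dvd_mult_iff[OF p] using not_dvd by blast
  then have p20: "\<not> p dvd 20" by simp
  have "\<not> 5 dvd 4 * p" using pq_mod(1) by presburger
  then have "\<not> 5 ^ 2 dvd 5 * (4 * p * q)" using *[OF prime5] not_dvd(6) by blast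
  then show "\<not> 5 ^ 2 dvd 20 * (p * q)" by (simp add: mult.assoc)
  show "\<not> 5 ^ 2 dvd 5 * (p * q)" using *[OF prime5] not_dvd by blast
  have "\<not> p ^ 2 dvd p * (5 * q)" using *[OF p] not_dvd by blast
  then show "\<not> p ^ 2 dvd 5 * (p * q)" by (subst mult.left_commute)
  have "\<not> q ^ 2 dvd q * (5 * p)" using *[OF q] not_dvd by blast
  then show "\<not> q ^ 2 dvd 5 * (p * q)" by (simp only: mult.commute[of p q] mult.left_commute[of 5 q p] not_False_eq_True)
  have "\<not> p ^ 2 dvd p * (20 * q)" using *[OF p] not_dvd p20 by blast
  then show "\<not> p ^ 2 dvd 20 * (p * q)" by (subst mult.left_commute)
qed

text \<open>Of the sixteen signed divisors, the prime 5 removes plus and minus \<open>p\<close>,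
  \<open>q\<close>, \<open>5 * p\<close>, \<open>5 * q\<close>; the prime \<open>p\<close> removes
  plus and minus \<open>5\<close> and \<open>p * q\<close>; and \<open>q\<close> removes
  \<open>- 1\<close> and \<open>5 * (p * q)\<close>. For a prime dividing \<open>d\<close> the
  condition falls on the cofactor \<open>b\<close>.\<close>

lemma square_class:
  assumes "y ^ 2 = x ^ 3 - of_int (5 * p * q) * x" "x \<noteq> (0::rat)"
  obtains t where "t \<noteq> 0" "x = t ^ 2 \<or> x = - of_int (5 * p * q) * t ^ 2"
proof -
  have "- (5 * (p * q)) \<noteq> 0" using pq_pos by simp
  moreover have "y ^ 2 = x ^ 3 + of_int (- (5 * (p * q))) * x" using assms(1) by simp
  ultimately obtain d b M e N where *: "- (5 * (p * q)) = d * b" "squarefree d" "M \<noteq> 0" "e \<noteq> 0"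
    "coprime (d * M) e" "N ^ 2 = d * M ^ 4 + b * e ^ 4" "x = of_int d * (of_int M / of_int e) ^ 2"
    using two_descent[OF _ _ assms(2)] by metis
  have d0: "d \<noteq> 0" using *(2) by auto
  have b: "b = c" if "- (5 * (p * q)) = d * c" for c
    using *(1) that d0 by simp
  have res: "if r dvd d then QuadRes r b else QuadRes r d" if "r \<in> {5, p, q}" for r
    by (rule quartic_QuadRes[OF _ _ _ *(6,5)])
      (use that p q not_square_dvd in \<open>auto simp flip: *(1)\<close>)
  have no5: False if "d = 5 * c" "- (p * q) = c * c'" "c' mod 5 = 2 \<or> c' mod 5 = 3" for c c'
    using res[of 5] b[of c'] not_QuadRes_5[OF that(3)] that(1,2) by simp
  have "d dvd 5 * (p * q)" using *(1) by (metis dvd_minus_iff dvd_triv_left)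
  from dvd_5pq[OF this] have "d = 1 \<or> d = - (5 * (p * q))"
  proof (rule contrapos_pp)
    assume "\<not> (d = 1 \<or> d = - (5 * (p * q)))"
    moreover have "d \<notin> {p, - p, q, - q}"
      using res[of 5] not_QuadRes_5[of d] not_dvd pq_mod by auto
    moreover have "d \<notin> {5 * q, - (5 * q), 5 * p, - (5 * p)}"
      using no5[of q "- p"] no5[of "- q" p] no5[of p "- q"] no5[of "- p" q] pq_mod by auto
    moreover have "d \<notin> {5, - 5}"
      using res[of p] not_dvd nonresidues by auto
    moreover have "d \<notin> {p * q, - (p * q)}"
      using res[of p] nonresidues b[of 5] b[of "- 5"] by auto
    moreover have "d \<noteq> - 1"
      using res[of q] nonresidues q by auto
    moreover have "d \<noteq> 5 * (p * q)"
      using res[of q] nonresidues b[of "- 1"] by auto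
    ultimately show "d \<notin> {1, - 1, q, - q, p, - p, p * q, - (p * q),
        5, - 5, 5 * q, - (5 * q), 5 * p, - (5 * p), 5 * (p * q), - (5 * (p * q))}"
      by blast
  qed
  moreover have "(of_int M / of_int e :: rat) \<noteq> 0" using * by simp
  ultimately show ?thesis using that[of "of_int M / of_int e"] *(7) by auto
qed

text \<open>The cofactors \<open>d\<close> and \<open>b\<close> have the same sign, so a negative
  \<open>d\<close> would make the quartic negative. Of the sixteen positive squarefree candidates, 5
  removes eight and \<open>p\<close> removes \<open>5\<close>, \<open>2 * q\<close>,
  \<open>p * q\<close> and \<open>10 * p\<close>.\<close>

lemma square_class_isogenous:
  assumes "y ^ 2 = x ^ 3 + of_int (20 * p * q) * x" "x \<noteq> (0::rat)"
  obtains t where "t \<noteq> 0" "x = t ^ 2 \<or> x = of_int (5 * p * q) * t ^ 2 \<or> x = of_int (2 * p) * t ^ 2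
    \<or> x = of_int (10 * q) * t ^ 2"
proof -
  have "20 * (p * q) \<noteq> 0" using pq_pos by simp
  moreover have "y ^ 2 = x ^ 3 + of_int (20 * (p * q)) * x" using assms(1) by simp
  ultimately obtain d b M e N where *: "20 * (p * q) = d * b" "squarefree d" "M \<noteq> 0" "e \<noteq> 0"
    "coprime (d * M) e" "N ^ 2 = d * M ^ 4 + b * e ^ 4" "x = of_int d * (of_int M / of_int e) ^ 2"
    using two_descent[OF _ _ assms(2)] by metis
  have d0: "d > 0"
  proof (rule ccontr)
    assume "\<not> d > 0"
    moreover have "d \<noteq> 0" using *(2) by auto
    ultimately have "d < 0" by simp
    moreover have "d * b > 0" using pq_pos by (simp flip: *(1))
    ultimately have "b < 0" by (simp add: zero_less_mult_iff)
    have "d * M ^ 4 < 0" "b * e ^ 4 < 0"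
      using \<open>d < 0\<close> \<open>b < 0\<close> *(3,4) by (simp_all add: mult_less_0_iff)
    then have "N ^ 2 < 0" using *(6) by linarith
    then show False by simp
  qed
  have b: "b = c" if "20 * (p * q) = d * c" for c
    using *(1) that d0 by simp
  have res: "if r dvd d then QuadRes r b else QuadRes r d" if "r \<in> {5, p}" for r
    by (rule quartic_QuadRes[OF _ _ _ *(6,5)])
      (use that p not_square_dvd in \<open>auto simp flip: *(1)\<close>)
  have no5: False if "d = 5 * c" "4 * (p * q) = c * c'" "c' mod 5 = 2 \<or> c' mod 5 = 3" for c c'
    using res[of 5] b[of c'] not_QuadRes_5[OF that(3)] that(1,2) by simp
  have two: "prime (2::int)" by simp
  have "20 * (p * q) = 2 * (2 * (5 * (p * q)))" by simp
  then have "d dvd 2 * (2 * (5 * (p * q)))" using *(1) by (metis dvd_triv_left)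
  with two have "d \<in> (\<lambda>x. 2 * x) ` {x. x dvd 5 * (p * q)} \<union> {x. x dvd 5 * (p * q)}"
  proof (cases rule: dvd_prime_mult_cases)
    case 1
    with two show ?thesis
      by (cases rule: dvd_prime_mult_cases) auto
  next
    case d': (2 d')
    from two d'(2) show ?thesis
    proof (cases rule: dvd_prime_mult_cases)
      case 1
      then show ?thesis using d' by auto
    next
      case (2 d'')
      then have "2 ^ 2 dvd d" using d' by simp
      then show ?thesis using squarefreeD[OF *(2), of 2] by simp
    qed
  qed
  then have D: "d \<in> {1, q, p, p * q, 5, 5 * q, 5 * p, 5 * (p * q), 2, 2 * q, 2 * p, 2 * (p * q),
      10, 10 * q, 10 * p, 10 * (p * q)}"
  proof (elim UnE imageE CollectE)
    fix x assume "d = 2 * x" "x dvd 5 * (p * q)"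
    then have "x > 0" using d0 by simp
    from dvd_5pq_pos[OF \<open>x dvd 5 * (p * q)\<close> this] show ?thesis
      by (elim insertE emptyE) (simp_all add: \<open>d = 2 * x\<close>)
  next
    assume "d dvd 5 * (p * q)"
    from dvd_5pq_pos[OF this d0] show ?thesis by blast
  qed
  from D have "d \<in> {1, 5 * (p * q), 2 * p, 10 * q}"
  proof (rule contrapos_pp)
    assume "d \<notin> {1, 5 * (p * q), 2 * p, 10 * q}"
    moreover have "d \<notin> {2, p, q, 2 * (p * q)}"
    proof
      assume "d \<in> {2, p, q, 2 * (p * q)}"
      then have d5: "d mod 5 = 2 \<or> d mod 5 = 3"
        by (elim insertE emptyE; hypsubst; simp add: pq_mod(1,2) pq_mod_5_multiples(1))
      then have "\<not> 5 dvd d" by auto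
      then show False using res[of 5] not_QuadRes_5[OF d5] by simp
    qed
    moreover have "d \<notin> {10 * (p * q), 5 * q, 10, 5 * p}"
      using no5[of "2 * (p * q)" 2, OF _ _ disjI1] no5[of q "4 * p", OF _ _ disjI1[OF pq_mod_5_multiples(2)]]
        no5[of 2 "2 * (p * q)", OF _ _ disjI1[OF pq_mod_5_multiples(1)]] no5[of p "4 * q", OF _ _ disjI2[OF pq_mod_5_multiples(3)]]
      by simp blast
    moreover have "\<not> p dvd 2 * q"
      unfolding prime_dvd_mult_iff[OF p] using not_dvd by blast
    then have "d \<noteq> 5" "d \<noteq> 2 * q"
      using res[of p] not_dvd(3) nonresidues(1,4) by auto
    moreover have "d \<noteq> p * q"
      using res[of p] nonresidues(3) b[of 20] by auto
    moreover have "d \<noteq> 10 * p"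
      using res[of p] nonresidues(4) b[of "2 * q"] by auto
    ultimately show "d \<notin> {1, q, p, p * q, 5, 5 * q, 5 * p, 5 * (p * q), 2, 2 * q, 2 * p, 2 * (p * q),
      10, 10 * q, 10 * p, 10 * (p * q)}"
      by blast
  qed
  moreover have "(of_int M / of_int e :: rat) \<noteq> 0" using * by simp
  ultimately show ?thesis using that[of "of_int M / of_int e"] *(7) by auto
qed

end

section \<open>Heights\<close>

definition rat_height :: "rat \<Rightarrow> int" where
  "rat_height x = max \<bar>fst (quotient_of x)\<bar> (snd (quotient_of x))"

lemma rat_height_quotient_of: "quotient_of x = (m, n) \<Longrightarrow> rat_height x = max \<bar>m\<bar> n"
  by (simp add: rat_height_def)

lemma rat_height_ge_1: "rat_height x \<ge> 1"
  using quotient_of_denom_pos'[of x] by (simp add: rat_height_def)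

lemma rat_height_fraction:
  fixes a b :: int
  assumes "x = of_int a / of_int b" "b \<noteq> 0"
  obtains c m n where "quotient_of x = (m, n)" "a = m * c" "b = n * c" "c \<noteq> 0"
proof -
  obtain m n where q: "quotient_of x = (m, n)" by force
  note n = quotient_of_denom_pos[OF q] quotient_of_coprime[OF q] quotient_of_div[OF q]
  have "of_int (a * n) = (of_int (m * b) :: rat)"
    using n(1,3) assms by (simp add: field_simps)
  then have eq: "a * n = m * b" by (simp only: of_int_eq_iff)
  then have "n dvd m * b" by (metis dvd_triv_right)
  then have "n dvd b" using n(2) by (simp add: coprime_commute coprime_dvd_mult_right_iff)
  then obtain c where c: "b = n * c" by auto
  have "a * n = m * c * n" using eq c by simp
  then have "a = m * c" using n(1) by simp
  then show ?thesis using that q c assms(2) by auto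
qed

lemma rat_height_le:
  fixes a b :: int
  assumes "x = of_int a / of_int b" "b \<noteq> 0"
  shows "rat_height x \<le> max \<bar>a\<bar> \<bar>b\<bar>"
proof -
  obtain c m n where *: "quotient_of x = (m, n)" "a = m * c" "b = n * c" "c \<noteq> 0"
    using rat_height_fraction[OF assms] .
  have "\<bar>c\<bar> \<ge> 1" using *(4) by simp
  then have "\<bar>m\<bar> * 1 \<le> \<bar>m\<bar> * \<bar>c\<bar>" "\<bar>n\<bar> * 1 \<le> \<bar>n\<bar> * \<bar>c\<bar>" by (intro mult_left_mono; simp)+
  then show ?thesis
    unfolding rat_height_quotient_of[OF *(1)] *(2,3) abs_mult by linarith
qed

text \<open>Passing to lowest terms divides the numerator by a common factor, and \<open>K\<close>
  bounds how much is lost.\<close>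

lemma rat_height_ge:
  fixes a b K :: int
  assumes "x = of_int a / of_int b" "b \<noteq> 0" "\<And>c. c dvd a \<Longrightarrow> c dvd b \<Longrightarrow> \<bar>c\<bar> \<le> K"
  shows "\<bar>a\<bar> \<le> K * rat_height x"
proof -
  obtain c m n where *: "quotient_of x = (m, n)" "a = m * c" "b = n * c" "c \<noteq> 0"
    using rat_height_fraction[OF assms(1,2)] .
  have "\<bar>c\<bar> \<le> K" using assms(3) * by simp
  moreover have "\<bar>m\<bar> \<le> rat_height x" unfolding rat_height_quotient_of[OF *(1)] by simp
  ultimately have "\<bar>c\<bar> * \<bar>m\<bar> \<le> K * rat_height x" by (intro mult_mono) auto
  then show ?thesis by (simp add: *(2) abs_mult mult.commute)
qed

lemma finite_rat_height_le: "finite {x. rat_height x \<le> B}"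
proof (rule finite_subset)
  show "{x. rat_height x \<le> B} \<subseteq> (\<lambda>(m, n). of_int m / of_int n) ` ({- B..B} \<times> {0..B})"
  proof
    fix x assume "x \<in> {x. rat_height x \<le> B}"
    moreover obtain m n where q: "quotient_of x = (m, n)" by force
    ultimately have "max \<bar>m\<bar> n \<le> B" by (simp add: rat_height_quotient_of)
    then have "(m, n) \<in> {- B..B} \<times> {0..B}" using quotient_of_denom_pos[OF q] by auto
    then show "x \<in> (\<lambda>(m, n). of_int m / of_int n) ` ({- B..B} \<times> {0..B})"
      using quotient_of_div[OF q] by (intro image_eqI[of _ _ "(m, n)"]) auto
  qed
qed auto

text \<open>The two expressions are numerator and denominator of the abscissa of the double of a
  point over \<open>m / n\<close>. The first is \<open>m ^ 4\<close> modulo \<open>n\<close>, so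
  \<open>c\<close> is prime to \<open>n\<close>. Each elimination below leaves a power of
  \<open>n\<close> that can be cancelled, and lowers the degree in \<open>m\<close> from 4 to 2 to
  0.\<close>

lemma doubling_common_divisor:
  fixes c m n D :: int
  assumes "coprime m n" "c dvd (m ^ 2 + D * n ^ 2) ^ 2" "c dvd 4 * m * n * (m ^ 2 - D * n ^ 2)"
  shows "c dvd 64 * D ^ 5"
proof -
  define A where "A = (m ^ 2 + D * n ^ 2) ^ 2"
  define B where "B = 4 * m * n * (m ^ 2 - D * n ^ 2)"
  have c: "c dvd A" "c dvd B" using assms by (simp_all add: A_def B_def)
  have "coprime A n"
  proof (rule coprimeI)
    fix e assume e: "e dvd A" "e dvd n"
    have "A = m ^ 4 + n * (2 * D * m ^ 2 * n + D ^ 2 * n ^ 3)"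
      unfolding A_def by (simp add: power2_eq_square power3_eq_cube power4_eq_xxxx algebra_simps)
    then have "e dvd m ^ 4" using e by (simp add: dvd_add_left_iff)
    moreover have "coprime (m ^ 4) n" using assms(1) by simp
    ultimately show "is_unit e" using e(2) coprime_common_divisor by blast
  qed
  then have cn: "coprime c (n ^ k)" for k
    using c(1) by (metis coprime_divisors coprime_power_right_iff dvd_refl)
  have "64 * D ^ 2 * m ^ 4 * n ^ 4 = 16 * D * m ^ 2 * n ^ 2 * A - D * B * B"
    unfolding A_def B_def by (simp add: eval_nat_numeral algebra_simps)
  then have "c dvd 64 * D ^ 2 * m ^ 4 * n ^ 4" using c by simp
  then have 1: "c dvd 64 * D ^ 2 * m ^ 4" using cn coprime_dvd_mult_left_iff by blast
  have "64 * D ^ 3 * (2 * m ^ 2 + D * n ^ 2) * n ^ 2 = 64 * D ^ 2 * A - 64 * D ^ 2 * m ^ 4"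
    unfolding A_def by (simp add: eval_nat_numeral algebra_simps)
  then have "c dvd 64 * D ^ 3 * (2 * m ^ 2 + D * n ^ 2) * n ^ 2" using c 1 by simp
  then have 2: "c dvd 64 * D ^ 3 * (2 * m ^ 2 + D * n ^ 2)" using cn coprime_dvd_mult_left_iff by blast
  have "64 * D ^ 5 * n ^ 4 = 256 * D ^ 3 * A -
      64 * D ^ 3 * (2 * m ^ 2 + D * n ^ 2) * (2 * m ^ 2 + 3 * D * n ^ 2)"
    unfolding A_def by (simp add: eval_nat_numeral algebra_simps)
  then have "c dvd 64 * D ^ 5 * n ^ 4" using c 2 by simp
  then show ?thesis using cn coprime_dvd_mult_left_iff by blast
qed

text \<open>
  Since \<open>D > 0\<close>, the numerator \<open>(m\<^sup>2 + D n\<^sup>2)\<^sup>2\<close> alone is at least the fourth power of the height, so only the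
  cancellation has to be controlled.
\<close>

lemma rat_height_double:
  fixes x y :: rat and D :: int
  assumes D: "D > 0" and eq: "y ^ 2 = x ^ 3 - of_int D * x" and y: "y \<noteq> 0"
  shows "rat_height x ^ 4 \<le> 64 * D ^ 5 * rat_height ((x ^ 2 + of_int D) ^ 2 / (4 * y ^ 2))"
proof -
  obtain m n where q: "quotient_of x = (m, n)" by force
  note n = quotient_of_denom_pos[OF q] quotient_of_coprime[OF q] quotient_of_div[OF q]
  let ?A = "(m ^ 2 + D * n ^ 2) ^ 2" and ?B = "4 * m * n * (m ^ 2 - D * n ^ 2)"
  have A: "of_int ?A = (x ^ 2 + of_int D) ^ 2 * of_int n ^ 4"
    unfolding n(3) using n(1) by (simp add: field_simps power2_eq_square power4_eq_xxxx)
  have B: "of_int ?B = 4 * y ^ 2 * of_int n ^ 4"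
    unfolding eq n(3) using n(1) by (simp add: field_simps power2_eq_square power3_eq_cube power4_eq_xxxx)
  have "of_int ?B \<noteq> (0 :: rat)" unfolding B using y n(1) by simp
  then have B0: "?B \<noteq> 0" by (simp only: of_int_0_eq_iff)
  have X: "(x ^ 2 + of_int D) ^ 2 / (4 * y ^ 2) = of_int ?A / of_int ?B"
    unfolding A B using n(1) by simp
  have "c dvd ?A \<Longrightarrow> c dvd ?B \<Longrightarrow> \<bar>c\<bar> \<le> 64 * D ^ 5" for c
    using doubling_common_divisor[OF n(2), of c D] D dvd_imp_le_int[of "64 * D ^ 5" c] by simp
  from rat_height_ge[OF X B0 this]
  have "\<bar>?A\<bar> \<le> 64 * D ^ 5 * rat_height ((x ^ 2 + of_int D) ^ 2 / (4 * y ^ 2))" .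
  moreover have "rat_height x ^ 4 \<le> ?A"
  proof -
    have "rat_height x ^ 2 = max (m ^ 2) (n ^ 2)"
      unfolding rat_height_quotient_of[OF q] using n(1) by (auto simp: max_def power2_le_iff_abs_le abs_le_square_iff[symmetric])
    moreover have "n ^ 2 \<le> D * n ^ 2" using D mult_right_mono[of 1 D "n ^ 2"] by simp
    ultimately have "rat_height x ^ 2 \<le> m ^ 2 + D * n ^ 2" by (smt (verit) zero_le_power2)
    then have "(rat_height x ^ 2) ^ 2 \<le> ?A" by (intro power_mono) auto
    then show ?thesis by simp
  qed
  ultimately show ?thesis by linarith
qed

text \<open>The fraction is the abscissa of \<open>(x, y) + (x0, y0)\<close>. Replacing
  \<open>y ^ 2\<close> and \<open>y0 ^ 2\<close> through the curve equation cancels the cubes and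
  leaves degree two in \<open>x\<close>, hence a quadratic bound.\<close>

lemma rat_height_add:
  fixes x y :: rat and D x0 y0 :: int
  assumes D: "D > 0" and eq: "y ^ 2 = x ^ 3 - of_int D * x" and x0: "x \<noteq> of_int x0"
  shows "rat_height ((- 2 * of_int y0 * y + of_int x0 * x ^ 2 + (of_int x0 ^ 2 - of_int D) * x - of_int D * of_int x0)
      / (x - of_int x0) ^ 2)
    \<le> (2 * \<bar>y0\<bar> * (1 + D) + \<bar>x0\<bar> + (x0 ^ 2 + D) + D * \<bar>x0\<bar> + (1 + \<bar>x0\<bar>) ^ 2) * rat_height x ^ 2"
proof -
  obtain m n where q: "quotient_of x = (m, n)" by force
  note n = quotient_of_denom_pos[OF q] quotient_of_coprime[OF q] quotient_of_div[OF q]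
  define h where "h = rat_height x"
  have h: "\<bar>m\<bar> \<le> h" "\<bar>n\<bar> \<le> h" "h \<ge> 0"
    using n(1) by (auto simp: h_def rat_height_quotient_of[OF q])
  \<comment> \<open>\<open>y * n ^ 2\<close> is rational with integral square, hence an integer, and
    that square is a quartic form in \<open>m\<close> and \<open>n\<close>; so its size is at most a
    constant times \<open>h ^ 2\<close>.\<close>
  have "(y * of_int n ^ 2) ^ 2 = of_int (m ^ 3 * n - D * (m * n ^ 3))"
    unfolding power_mult_distrib eq n(3) using n(1)
    by (simp add: field_simps power2_eq_square power3_eq_cube)
  moreover obtain Y where Y: "y * of_int n ^ 2 = of_int Y"
    using rat_square_int calculation by blast
  ultimately have "of_int (Y ^ 2) = (of_int (m ^ 3 * n - D * (m * n ^ 3)) :: rat)" by simp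
  then have Y2: "Y ^ 2 = m ^ 3 * n - D * (m * n ^ 3)" by (simp only: of_int_eq_iff)
  have mono: "\<bar>u * v\<bar> \<le> h ^ (i + j)" if "\<bar>u\<bar> \<le> h ^ i" "\<bar>v\<bar> \<le> h ^ j" for u v i j
    unfolding abs_mult power_add using that by (intro mult_mono) auto
  have pw: "\<bar>m ^ i\<bar> \<le> h ^ i" "\<bar>n ^ i\<bar> \<le> h ^ i" for i
    using h by (simp_all add: power_abs power_mono)
  have b4: "\<bar>m ^ 3 * n\<bar> \<le> h ^ 4" "\<bar>m * n ^ 3\<bar> \<le> h ^ 4"
    using mono[OF pw(1)[of 3] pw(2)[of 1]] mono[OF pw(1)[of 1] pw(2)[of 3]] by simp_all
  have b2: "\<bar>m ^ 2\<bar> \<le> h ^ 2" "\<bar>m * n\<bar> \<le> h ^ 2" "\<bar>n ^ 2\<bar> \<le> h ^ 2"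
    using pw[of 2] mono[OF pw(1)[of 1] pw(2)[of 1]] by (simp_all add: power2_eq_square)
  have "\<bar>D * (m * n ^ 3)\<bar> \<le> D * h ^ 4" using b4(2) D by (simp add: abs_mult)
  then have "Y ^ 2 \<le> (1 + D) * h ^ 4" using Y2 b4(1) by (simp add: algebra_simps abs_le_iff)
  also have "\<dots> \<le> (1 + D) ^ 2 * h ^ 4" using D by (intro mult_right_mono) (auto simp: power2_eq_square)
  also have "\<dots> = ((1 + D) * h ^ 2) ^ 2" by (simp add: power_mult_distrib)
  finally have Yb: "\<bar>Y\<bar> \<le> (1 + D) * h ^ 2"
    using power2_le_imp_le[of "\<bar>Y\<bar>" "(1 + D) * h ^ 2"] D by simp
  let ?N = "- 2 * y0 * Y + x0 * m ^ 2 + (x0 ^ 2 - D) * (m * n) - D * x0 * n ^ 2" and ?d = "(m - x0 * n) ^ 2"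
  have d: "of_int ?d = (x - of_int x0) ^ 2 * of_int n ^ 2"
    unfolding n(3) using n(1) by (simp add: field_simps power2_eq_square)
  have N: "of_int ?N = (- 2 * of_int y0 * y + of_int x0 * x ^ 2 + (of_int x0 ^ 2 - of_int D) * x - of_int D * of_int x0) * of_int n ^ 2"
  proof -
    have "of_int ?N = - 2 * of_int y0 * (y * of_int n ^ 2) + of_int x0 * (x * of_int n) ^ 2
        + (of_int x0 ^ 2 - of_int D) * (x * of_int n * of_int n) - of_int D * of_int x0 * of_int n ^ 2"
      unfolding Y n(3) using n(1) by simp
    then show ?thesis by (simp add: algebra_simps power2_eq_square)
  qed
  have "of_int ?d \<noteq> (0::rat)" unfolding d using x0 n(1) by simp
  then have d0: "?d \<noteq> 0" by (simp only: of_int_0_eq_iff)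
  have X: "(- 2 * of_int y0 * y + of_int x0 * x ^ 2 + (of_int x0 ^ 2 - of_int D) * x - of_int D * of_int x0)
      / (x - of_int x0) ^ 2 = of_int ?N / of_int ?d"
    unfolding N d using n(1) by simp
  have "\<bar>?N\<bar> \<le> \<bar>2 * y0 * Y\<bar> + \<bar>x0 * m ^ 2\<bar> + \<bar>(x0 ^ 2 - D) * (m * n)\<bar> + \<bar>D * x0 * n ^ 2\<bar>"
    by linarith
  also have "\<dots> \<le> 2 * \<bar>y0\<bar> * ((1 + D) * h ^ 2) + \<bar>x0\<bar> * h ^ 2 + (x0 ^ 2 + D) * h ^ 2 + (D * \<bar>x0\<bar>) * h ^ 2"
  proof (intro add_mono)
    show "\<bar>2 * y0 * Y\<bar> \<le> 2 * \<bar>y0\<bar> * ((1 + D) * h ^ 2)"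
      unfolding abs_mult using Yb by (intro mult_mono) auto
    show "\<bar>x0 * m ^ 2\<bar> \<le> \<bar>x0\<bar> * h ^ 2" unfolding abs_mult using b2 by (intro mult_mono) auto
    have "\<bar>x0 ^ 2 - D\<bar> \<le> x0 ^ 2 + D" using D by (simp add: abs_le_iff)
    then show "\<bar>(x0 ^ 2 - D) * (m * n)\<bar> \<le> (x0 ^ 2 + D) * h ^ 2"
      unfolding abs_mult[of "x0 ^ 2 - D"] using b2 D by (intro mult_mono) auto
    show "\<bar>D * x0 * n ^ 2\<bar> \<le> (D * \<bar>x0\<bar>) * h ^ 2"
      unfolding abs_mult using b2 D by (intro mult_mono) auto
  qed
  finally have Nb: "\<bar>?N\<bar> \<le> (2 * \<bar>y0\<bar> * (1 + D) + \<bar>x0\<bar> + (x0 ^ 2 + D) + D * \<bar>x0\<bar>) * h ^ 2"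
    by (simp add: algebra_simps)
  have "\<bar>m - x0 * n\<bar> \<le> \<bar>m\<bar> + \<bar>x0\<bar> * \<bar>n\<bar>" using abs_triangle_ineq4[of m "x0 * n"] by (simp add: abs_mult)
  also have "\<dots> \<le> h + \<bar>x0\<bar> * h" using h by (intro add_mono mult_left_mono) auto
  finally have "\<bar>m - x0 * n\<bar> \<le> (1 + \<bar>x0\<bar>) * h" by (simp add: algebra_simps)
  then have "\<bar>m - x0 * n\<bar> ^ 2 \<le> ((1 + \<bar>x0\<bar>) * h) ^ 2" by (intro power_mono) auto
  then have db: "\<bar>?d\<bar> \<le> (1 + \<bar>x0\<bar>) ^ 2 * h ^ 2" by (simp add: power_mult_distrib)
  have "rat_height (of_int ?N / of_int ?d) \<le> max \<bar>?N\<bar> \<bar>?d\<bar>"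
    by (rule rat_height_le[OF refl d0])
  also have "\<dots> \<le> \<bar>?N\<bar> + \<bar>?d\<bar>" by simp
  also have "\<dots> \<le> (2 * \<bar>y0\<bar> * (1 + D) + \<bar>x0\<bar> + (x0 ^ 2 + D) + D * \<bar>x0\<bar>) * h ^ 2 + (1 + \<bar>x0\<bar>) ^ 2 * h ^ 2"
    using Nb db by (rule add_mono)
  finally show ?thesis unfolding X h_def by (simp add: algebra_simps)
qed

lemma rat_height_translate_origin:
  fixes x :: rat and D :: int
  assumes "D > 0" "x \<noteq> 0"
  shows "rat_height (- of_int D / x) \<le> D * rat_height x"
proof -
  obtain m n where q: "quotient_of x = (m, n)" by force
  note n = quotient_of_denom_pos[OF q] quotient_of_div[OF q]
  have m: "m \<noteq> 0" using assms(2) n by auto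
  have "rat_height (- of_int D / x) \<le> max \<bar>- D * n\<bar> \<bar>m\<bar>"
    using m n by (intro rat_height_le) (simp_all add: n(2))
  also have "\<dots> \<le> D * max \<bar>m\<bar> n"
  proof -
    have "\<bar>m\<bar> \<le> D * \<bar>m\<bar>" "D * \<bar>m\<bar> \<le> D * max \<bar>m\<bar> n" "D * n \<le> D * max \<bar>m\<bar> n"
      using assms(1) mult_right_mono[of 1 D "\<bar>m\<bar>"] by simp_all
    moreover have "\<bar>- D * n\<bar> = D * n" using n(1) assms(1) by (simp add: abs_mult)
    ultimately show ?thesis by (intro max.boundedI) linarith+
  qed
  finally show ?thesis unfolding rat_height_quotient_of[OF q] .
qed

section \<open>Rank one\<close>

text \<open>Natural numbers suit the induction in \<open>has_rank_1_descent\<close>. The value 1 at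
  \<open>Infinity\<close> keeps all heights positive, so that constants can be absorbed into
  factors.\<close>

fun point_height :: "rat point \<Rightarrow> nat" where
  "point_height Infinity = 1"
| "point_height (Affine x y) = nat (rat_height x)"

lemma point_height_ge_1: "point_height P \<ge> 1"
proof (cases P)
  case (Affine x y)
  then show ?thesis using nat_mono[OF rat_height_ge_1[of x]] by simp
qed simp

lemma finite_point_height_le: "finite {P \<in> ec_points a b. point_height P \<le> n}"
proof (rule finite_subset)
  let ?X = "{x. rat_height x \<le> int n}"
  show "{P \<in> ec_points a b. point_height P \<le> n} \<subseteq>
      insert Infinity (\<Union>x\<in>?X. Affine x ` {y. y ^ 2 = x ^ 3 + a * x + b})"
  proof
    fix P assume "P \<in> {P \<in> ec_points a b. point_height P \<le> n}"
    then show "P \<in> insert Infinity (\<Union>x\<in>?X. Affine x ` {y. y ^ 2 = x ^ 3 + a * x + b})"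
      by (cases P) (auto simp: nat_le_iff)
  qed
  have "finite {y. y ^ 2 = c}" for c :: rat
  proof (cases "\<exists>z. z ^ 2 = c")
    case True
    then obtain z where "z ^ 2 = c" by blast
    then have "{y. y ^ 2 = c} \<subseteq> {z, - z}" by (auto simp: power2_eq_iff)
    then show ?thesis by (rule finite_subset) simp
  qed auto
  then show "finite (insert Infinity (\<Union>x\<in>?X. Affine x ` {y. y ^ 2 = x ^ 3 + a * x + b}))"
    using finite_rat_height_le by auto
qed

lemma point_height_translate_origin:
  fixes D :: int
  assumes E: "elliptic_curve (- of_int D :: rat) 0" and D: "D > 0"
    and Q: "Q \<in> ec_points (- of_int D) 0" and T: "T \<in> {Infinity, Affine 0 0}"
  shows "point_height (ec_add (- of_int D) Q T) \<le> nat D * point_height Q"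
proof -
  have "1 \<le> nat D" using D by linarith
  then have D1: "n \<le> nat D * n" for n using mult_le_mono1[of 1 "nat D" n] by simp
  consider "T = Infinity" | "T = Affine 0 0" "Q = Infinity" | y where "T = Affine 0 0" "Q = Affine 0 y"
    | x y where "T = Affine 0 0" "Q = Affine x y" "x \<noteq> 0"
    using T by (cases Q) auto
  then show ?thesis
  proof cases
    case 1
    then show ?thesis using D1 by simp
  next
    case 2
    then show ?thesis using D by (simp add: rat_height_def)
  next
    case 3
    then have "y = 0" using Q by simp
    then have "ec_add (- of_int D) Q T = Infinity" using 3 by (simp add: ec_add.simps(3))
    then show ?thesis using D1[of 1] 3 by (simp add: rat_height_def)
  next
    case 4
    have "ec_add (- of_int D) Q T = Affine (- of_int D / x) (- (- of_int D * y / x ^ 2))"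
      using ec_add_origin[OF E, of y x] Q 4 by simp
    moreover have "nat (rat_height (- of_int D / x)) \<le> nat (D * rat_height x)"
      using rat_height_translate_origin[OF D 4(3)] by (rule nat_mono)
    ultimately show ?thesis using 4 D by (simp add: nat_mult_distrib)
  qed
qed

lemma point_height_double:
  fixes D :: int
  assumes E: "elliptic_curve (- of_int D :: rat) 0" and D: "D > 0"
    and ns: "\<And>r::rat. r ^ 2 \<noteq> of_int D"
    and R: "R \<in> ec_points (- of_int D) 0"
  shows "point_height R ^ 4 \<le> nat (64 * D ^ 5) * point_height (ec_add (- of_int D) R R)"
proof -
  have D1: "1 \<le> nat (64 * D ^ 5)"
    using D zero_less_power[of D 5] by linarith
  show ?thesis
  proof (cases R)
    case Infinity
    then show ?thesis using D1 by simp
  next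
    case (Affine x y)
    then have eq: "y ^ 2 = x ^ 3 - of_int D * x" using R by simp
    show ?thesis
    proof (cases "y = 0")
      case True
      then have "x * (x ^ 2 - of_int D) = 0"
        using eq True by Groebner_Basis.algebra
      then have "x = 0" using ns[of x] by auto
      then show ?thesis using True D1 Affine by (simp add: ec_add.simps(3) rat_height_def)
    next
      case False
      have "y ^ 2 = x ^ 3 + - of_int D * x" using eq by simp
      then obtain Y where Y: "ec_add (- of_int D) R R = Affine ((x ^ 2 + of_int D) ^ 2 / (4 * y ^ 2)) Y"
        using ec_double[OF E _ False] Affine by (metis diff_minus_eq_add)
      have "nat (rat_height x ^ 4) \<le> nat (64 * D ^ 5 * rat_height ((x ^ 2 + of_int D) ^ 2 / (4 * y ^ 2)))"
        using rat_height_double[OF D eq False] by (rule nat_mono)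
      then show ?thesis
        using D rat_height_ge_1[of x] unfolding Y
        by (simp add: Affine nat_mult_distrib nat_power_eq)
    qed
  qed
qed

lemma point_height_add:
  fixes D x0 y0 :: int
  assumes E: "elliptic_curve (- of_int D :: rat) 0" and D: "D > 0"
    and P: "Affine (of_int x0) (of_int y0) \<in> ec_points (- of_int D :: rat) 0"
  obtains C where "\<And>Q. Q \<in> ec_points (- of_int D) 0 \<Longrightarrow>
    point_height (ec_add (- of_int D) Q (Affine (of_int x0) (of_int y0))) \<le> C * point_height Q ^ 2"
proof
  let ?a = "- of_int D :: rat"
  let ?P = "Affine (of_int x0) (of_int y0) :: rat point"
  define K where "K = 2 * \<bar>y0\<bar> * (1 + D) + \<bar>x0\<bar> + (x0 ^ 2 + D) + D * \<bar>x0\<bar> + (1 + \<bar>x0\<bar>) ^ 2"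
  \<comment> \<open>The extra summands cover the points to which the chord formula does not apply:
    \<open>Infinity\<close>, the fixed point itself, and its negative, for which the sum has height
    1.\<close>
  define C where "C = nat K + point_height ?P + point_height (ec_add ?a ?P ?P) + 1"
  fix Q assume Q: "Q \<in> ec_points ?a 0"
  have C: "k \<le> C \<Longrightarrow> k \<le> C * point_height Q ^ 2" for k
    using point_height_ge_1[of Q] by (metis le_trans mult_le_mono nat_mult_1_right one_le_power order_refl)
  show "point_height (ec_add ?a Q ?P) \<le> C * point_height Q ^ 2"
  proof (cases Q)
    case Infinity
    then show ?thesis by (simp add: C_def)
  next
    case (Affine x y)
    have eqQ: "y ^ 2 = x ^ 3 - of_int D * x" using Q Affine by simp
    have eqP: "(of_int y0 :: rat) ^ 2 = of_int x0 ^ 3 - of_int D * of_int x0" using P by simp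
    show ?thesis
    proof (cases "x = of_int x0")
      case True
      then have "y ^ 2 = (of_int y0) ^ 2" using eqQ eqP by simp
      then have "y = of_int y0 \<or> y = - of_int y0" by (simp add: power2_eq_iff)
      then have "Q = ?P \<or> ec_add ?a Q ?P = Infinity"
        using True Affine by (auto simp: ec_add.simps(3))
      then have "point_height (ec_add ?a Q ?P) \<le> C" by (auto simp: C_def)
      then show ?thesis by (rule C)
    next
      case False
      have "y ^ 2 = x ^ 3 + ?a * x + 0" "of_int y0 ^ 2 = of_int x0 ^ 3 + ?a * of_int x0 + 0"
        using eqQ eqP by simp_all
      then obtain m c x3 where l: "ec_line ?a 0 m c x (of_int x0) x3" "y = m * x + c" "of_int y0 = m * of_int x0 + c"
        using ec_line_exists False by metis
      have s: "ec_add ?a Q ?P = Affine x3 (- (m * x3 + c))"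
        using ec_line_collinear(1)[OF E l(1)] Affine l(2,3) by simp
      have "x3 = m ^ 2 - x - of_int x0" using l(1) by (simp add: ec_line_def)
      then have "x3 * (x - of_int x0) ^ 2 = - 2 * of_int y0 * y + of_int x0 * x ^ 2
          + (of_int x0 ^ 2 - of_int D) * x - of_int D * of_int x0"
        using l(2,3) eqQ eqP by Groebner_Basis.algebra
      then have x3: "x3 = (- 2 * of_int y0 * y + of_int x0 * x ^ 2
          + (of_int x0 ^ 2 - of_int D) * x - of_int D * of_int x0) / (x - of_int x0) ^ 2"
        using False by (simp add: eq_divide_eq)
      have "rat_height x3 \<le> K * rat_height x ^ 2"
        unfolding x3 K_def by (rule rat_height_add[OF D eqQ False])
      then have "nat (rat_height x3) \<le> nat (K * rat_height x ^ 2)" by (rule nat_mono)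
      also have "\<dots> = nat K * point_height Q ^ 2"
        using rat_height_ge_1[of x] Affine D by (simp add: nat_mult_distrib nat_power_eq K_def)
      also have "\<dots> \<le> C * point_height Q ^ 2"
        unfolding C_def by (intro mult_le_mono1) simp
      finally show ?thesis by (simp add: s)
    qed
  qed
qed

section \<open>The curve for D = 5pq\<close>

context descent_primes
begin

abbreviation D :: int where "D \<equiv> 5 * p * q"

lemma D_pos: "D > 0"
  using pq_pos by simp

lemma elliptic: "elliptic_curve (- of_int D :: rat) 0"
  using pq_pos by (simp add: elliptic_curve_def)

lemma not_rat_square:
  assumes "prime r" "r dvd k" "\<not> r ^ 2 dvd k"
  shows "(x::rat) ^ 2 \<noteq> of_int k"
proof
  assume x: "x ^ 2 = of_int k"
  then obtain j where "x = of_int j" by (rule rat_square_int)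
  with x have "of_int (j ^ 2) = (of_int k :: rat)" by simp
  then have "j ^ 2 = k" by (simp only: of_int_eq_iff)
  moreover then have "r dvd j" using assms(1,2) prime_dvd_power by blast
  ultimately show False using assms(3) by auto
qed

lemma not_rat_squares:
  "(x::rat) ^ 2 \<noteq> of_int D" "(x::rat) ^ 2 \<noteq> of_int (2 * p)" "(x::rat) ^ 2 \<noteq> of_int (10 * q)"
proof -
  show "x ^ 2 \<noteq> of_int D"
    by (rule not_rat_square[OF prime5]) (use not_square_dvd(1) in \<open>simp_all add: mult.assoc\<close>)
  have "\<not> p * p dvd 2 * p" using not_dvd pq_pos by simp
  then show "x ^ 2 \<noteq> of_int (2 * p)"
    by (intro not_rat_square[OF p]) (simp_all add: power2_eq_square)
  have "\<not> q dvd 5 * 2" unfolding prime_dvd_mult_iff[OF q] using not_dvd by blast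
  then have "\<not> q * q dvd 10 * q" using pq_pos by simp
  then show "x ^ 2 \<noteq> of_int (10 * q)"
    by (intro not_rat_square[OF q]) (simp_all add: power2_eq_square)
qed

lemma square_x_coordinate:
  assumes Q: "Affine x y \<in> ec_points (- of_int D :: rat) 0" and x: "x \<noteq> 0"
  obtains T u w where "T \<in> {Infinity, Affine 0 0}" "u \<noteq> 0" "w ^ 2 = u ^ 4 - of_int D"
    "ec_add (- of_int D) (Affine x y) T = Affine (u ^ 2) (u * w)"
proof -
  let ?a = "- of_int D :: rat"
  have root: "(Y / u) ^ 2 = u ^ 4 - of_int D" "Y = u * (Y / u)"
    if "Affine (u ^ 2) Y \<in> ec_points ?a 0" "u \<noteq> 0" for u Y
  proof -
    have "Y ^ 2 = u ^ 2 * (u ^ 4 - of_int D)"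
      using that(1) by (simp add: algebra_simps flip: power_mult power_add)
    then show "(Y / u) ^ 2 = u ^ 4 - of_int D" using that(2) by (simp add: power_divide)
  qed (use that(2) in simp)
  have eq: "y ^ 2 = x ^ 3 - of_int D * x" using Q by simp
  then obtain t where t: "t \<noteq> 0" "x = t ^ 2 \<or> x = - of_int D * t ^ 2"
    using square_class x by metis
  from t(2) show ?thesis
  proof
    assume xt: "x = t ^ 2"
    then show ?thesis
      using that[of Infinity t "y / t"] root[of t y] Q t(1) by simp
  next
    assume xt: "x = - of_int D * t ^ 2"
    define Y where "Y = - (?a * y / x ^ 2)"
    have "?a / x = (1 / t) ^ 2" using D_pos t(1) pq_pos by (simp add: xt power_divide)
    moreover have "ec_add ?a (Affine x y) (Affine 0 0) = Affine (?a / x) Y"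
      unfolding Y_def using ec_add_origin[OF elliptic _ x] eq by simp
    ultimately have s: "ec_add ?a (Affine x y) (Affine 0 0) = Affine ((1 / t) ^ 2) Y" by simp
    have "Affine ((1 / t) ^ 2) Y \<in> ec_points ?a 0"
      unfolding s[symmetric] by (rule ec_add_closed[OF elliptic Q]) simp
    then show ?thesis
      using that[of "Affine 0 0" "1 / t" "Y / (1 / t)"] root[of "1 / t" Y] t(1) s by simp
  qed
qed

text \<open>Changing the signs of both \<open>u\<close> and \<open>w\<close> keeps the point but
  exchanges its two preimages under the isogeny. Their abscissas have product \<open>4 * D\<close>,
  so the class of \<open>D\<close> passes to that of 1 and the class of \<open>10 * q\<close> to
  that of \<open>2 * p\<close>.\<close>

lemma normalize_coset:
  assumes w: "(w::rat) ^ 2 = u ^ 4 - of_int D" and u: "u \<noteq> 0"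
  obtains u' w' \<tau> where "u' ^ 2 = u ^ 2" "u' * w' = u * w" "w' ^ 2 = u' ^ 4 - of_int D"
    "2 * (u' ^ 2 + w') = \<tau> ^ 2 \<or> 2 * (u' ^ 2 + w') = of_int (2 * p) * \<tau> ^ 2"
proof -
  define z where "z = 2 * (u ^ 2 + w)"
  have zz: "z * (2 * (u ^ 2 - w)) = 4 * of_int D"
    using w unfolding z_def by Groebner_Basis.algebra
  then have z0: "z \<noteq> 0" using D_pos by (metis mult_eq_0_iff of_int_eq_0_iff order_less_irrefl zero_neq_numeral)
  have "(2 * u * z) ^ 2 = z ^ 3 + 4 * of_int D * z"
    using w unfolding z_def by Groebner_Basis.algebra
  then have "(2 * u * z) ^ 2 = z ^ 3 + of_int (20 * p * q) * z" by simp
  then obtain t where t: "t \<noteq> 0" "z = t ^ 2 \<or> z = of_int D * t ^ 2 \<or> z = of_int (2 * p) * t ^ 2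
      \<or> z = of_int (10 * q) * t ^ 2"
    using square_class_isogenous z0 by metis
  have z': "2 * ((- u) ^ 2 + - w) = 4 * of_int D / z" using zz z0 by (simp add: field_simps)
  have w': "(- w) ^ 2 = (- u) ^ 4 - of_int D" using w by simp
  from t(2) show ?thesis
  proof (elim disjE)
    assume "z = t ^ 2"
    then show ?thesis using that[of u w t] w by (simp add: z_def)
  next
    assume "z = of_int D * t ^ 2"
    then have "2 * ((- u) ^ 2 + - w) = (2 / t) ^ 2"
      unfolding z' using D_pos pq_pos by (simp add: power_divide)
    then show ?thesis using that[of "- u" "- w" "2 / t"] w' by simp
  next
    assume "z = of_int (2 * p) * t ^ 2"
    then show ?thesis using that[of u w t] w by (simp add: z_def)
  next
    assume "z = of_int (10 * q) * t ^ 2"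
    then have "2 * ((- u) ^ 2 + - w) = of_int (2 * p) * (1 / t) ^ 2"
      unfolding z' using D_pos pq_pos by (simp add: power_divide)
    then show ?thesis using that[of "- u" "- w" "1 / t"] w' by simp
  qed
qed

definition P0 :: "rat point" where
  "P0 = Affine (of_int (4 * s ^ 2)) (of_int (s * (p - 5 * q)))"

lemma s_nz: "s \<noteq> 0"
  using s pq_pos by auto

text \<open>\<open>u0 ^ 2\<close> is half the sum and \<open>w0\<close> half the difference of
  \<open>p\<close> and \<open>5 * q\<close>, whose product is \<open>D\<close>; so
  \<open>u0 ^ 4 - w0 ^ 2 = D\<close>. The last equation places the point in the class of
  \<open>2 * p\<close>.\<close>

lemma P0_alt:
  defines "u0 \<equiv> 2 * of_int s :: rat" and "w0 \<equiv> (of_int p - 5 * of_int q) / 2 :: rat"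
  shows "P0 = Affine (u0 ^ 2) (u0 * w0)" "w0 ^ 2 = u0 ^ 4 - of_int D" "2 * (u0 ^ 2 + w0) = of_int (2 * p)"
proof -
  have "of_int (p + 5 * q) = (of_int (8 * s ^ 2) :: rat)" using s by simp
  then have s': "of_int p + 5 * of_int q = 8 * (of_int s :: rat) ^ 2" by simp
  have w0: "2 * w0 = of_int p - 5 * of_int q" by (simp add: w0_def)
  show "P0 = Affine (u0 ^ 2) (u0 * w0)"
    by (simp add: P0_def u0_def w0_def power_mult_distrib)
  have "4 * w0 ^ 2 = 4 * (u0 ^ 4 - of_int D)"
  proof -
    have "4 * w0 ^ 2 = (of_int p + 5 * of_int q) ^ 2 - 20 * of_int p * of_int q"
      using w0 by Groebner_Basis.algebra
    also have "\<dots> = (8 * of_int s ^ 2) ^ 2 - 20 * of_int p * of_int q" unfolding s' ..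
    finally show ?thesis by (simp add: u0_def power_mult_distrib flip: power_mult)
  qed
  then show "w0 ^ 2 = u0 ^ 4 - of_int D" by simp
  show "2 * (u0 ^ 2 + w0) = of_int (2 * p)"
    using w0 s' by (simp add: u0_def power_mult_distrib)
qed

lemma P0_in: "P0 \<in> ec_points (- of_int D) 0"
proof -
  define u0 :: rat where "u0 = 2 * of_int s"
  define w0 :: rat where "w0 = (of_int p - 5 * of_int q) / 2"
  note P0' = P0_alt[folded u0_def w0_def]
  have "(u0 * w0) ^ 2 = (u0 ^ 2) ^ 3 + - of_int D * u0 ^ 2"
    unfolding power_mult_distrib P0'(2) by (simp add: algebra_simps flip: power_mult power_add)
  then show ?thesis by (simp add: P0'(1))
qed

lemma coset_representatives:
  assumes Q: "Affine x y \<in> ec_points (- of_int D :: rat) 0" and x: "x \<noteq> 0"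
  obtains T where "T \<in> {Infinity, Affine 0 0}"
    "ec_add (- of_int D) (Affine x y) T \<in> {P0, ec_neg P0}
     \<or> (\<exists>R\<in>ec_points (- of_int D) 0. ec_add (- of_int D) R R = ec_add (- of_int D) (Affine x y) T)
     \<or> (\<exists>R\<in>ec_points (- of_int D) 0. ec_add (- of_int D) R R = ec_add (- of_int D) (ec_add (- of_int D) (Affine x y) T) P0)"
proof -
  let ?a = "- of_int D :: rat"
  obtain T u1 w1 where T: "T \<in> {Infinity, Affine 0 0}" and u1: "u1 \<noteq> 0" "w1 ^ 2 = u1 ^ 4 - of_int D"
    "ec_add ?a (Affine x y) T = Affine (u1 ^ 2) (u1 * w1)"
    using square_x_coordinate[OF Q x] .
  obtain u w \<tau> where uw: "u ^ 2 = u1 ^ 2" "u * w = u1 * w1" "w ^ 2 = u ^ 4 - of_int D"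
    "2 * (u ^ 2 + w) = \<tau> ^ 2 \<or> 2 * (u ^ 2 + w) = of_int (2 * p) * \<tau> ^ 2"
    using normalize_coset[OF u1(2,1)] .
  have Q': "ec_add ?a (Affine x y) T = Affine (u ^ 2) (u * w)" using u1(3) uw(1,2) by simp
  have w: "w ^ 2 = u ^ 4 + ?a" using uw(3) by simp
  from uw(4) show ?thesis
  proof
    assume "2 * (u ^ 2 + w) = \<tau> ^ 2"
    from ec_halving[OF elliptic w this] show ?thesis using that[OF T] unfolding Q' by blast
  next
    assume \<tau>: "2 * (u ^ 2 + w) = of_int (2 * p) * \<tau> ^ 2"
    define u0 :: rat where "u0 = 2 * of_int s"
    define w0 :: rat where "w0 = (of_int p - 5 * of_int q) / 2"
    note P0' = P0_alt[folded u0_def w0_def]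
    show ?thesis
    proof (cases "u ^ 2 = u0 ^ 2")
      case True
      \<comment> \<open>The formula in \<open>ec_square_coset_add\<close> needs distinct abscissas.
        With equal ones the point is \<open>P0\<close> or its negative, which is why these two are
        listed separately.\<close>
      have "w ^ 2 = w0 ^ 2" using uw(3) P0'(2) True by (metis power4_eq_xxxx power2_eq_square mult.assoc)
      then have "u = u0 \<or> u = - u0" "w = w0 \<or> w = - w0" using True by (auto simp: power2_eq_iff)
      then have "Affine (u ^ 2) (u * w) \<in> {P0, ec_neg P0}" using P0'(1) True by auto
      then show ?thesis using that[OF T] unfolding Q' by blast
    next
      case False
      have w0: "w0 ^ 2 = u0 ^ 4 + ?a" using P0'(2) by simp
      have c: "u ^ 2 + w = (u0 ^ 2 + w0) * \<tau> ^ 2" using \<tau> P0'(3) by Groebner_Basis.algebra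
      have "u0 ^ 2 + w0 \<noteq> 0" using P0'(3) pq_pos by auto
      from ec_square_coset_add[OF elliptic w w0 c this False]
      obtain u' v' w' where *: "w' ^ 2 = u' ^ 4 + ?a" "2 * (u' ^ 2 + w') = v' ^ 2"
        "ec_add ?a (Affine (u ^ 2) (u * w)) (Affine (u0 ^ 2) (u0 * w0)) = Affine (u' ^ 2) (u' * w')" .
      from ec_halving[OF elliptic *(1,2)] show ?thesis
        using that[OF T] unfolding Q' P0'(1) *(3) by blast
    qed
  qed
qed

lemma double_x_coordinate:
  assumes R: "R \<in> ec_points (- of_int D :: rat) 0" and "ec_add (- of_int D) R R = Affine X Y"
  obtains x y where "y \<noteq> 0" "y ^ 2 = x ^ 3 - of_int D * x" "X = (x ^ 2 + of_int D) ^ 2 / (4 * y ^ 2)"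
proof (cases R)
  case Infinity
  then show ?thesis using assms(2) by simp
next
  case (Affine x y)
  have y: "y \<noteq> 0" using assms(2) Affine by (auto simp: ec_add.simps(3))
  have eq: "y ^ 2 = x ^ 3 + - of_int D * x" using R Affine by simp
  obtain Y' where "ec_add (- of_int D) R R = Affine ((x ^ 2 - - of_int D) ^ 2 / (4 * y ^ 2)) Y'"
    using ec_double[OF elliptic eq y] Affine by metis
  then show ?thesis using that[OF y] eq assms(2) by simp
qed

text \<open>This excludes as doubles both \<open>(0, 0)\<close> and its sum with \<open>P0\<close>,
  whose abscissa is negative.\<close>

lemma double_x_pos:
  assumes R: "R \<in> ec_points (- of_int D :: rat) 0" and "ec_add (- of_int D) R R = Affine X Y"
  shows "X > 0"
proof -
  obtain x y where xy: "y \<noteq> 0" "X = (x ^ 2 + of_int D) ^ 2 / (4 * y ^ 2)"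
    using double_x_coordinate[OF assms] by metis
  have "x ^ 2 + of_int D > 0" using D_pos by (intro add_nonneg_pos) (simp_all del: of_int_mult)
  then show ?thesis using xy by simp
qed

text \<open>If \<open>P0\<close> is the double of \<open>(x, y)\<close>, then
  \<open>(y / x) ^ 2\<close> is the abscissa of the image of \<open>(x, y)\<close> on the isogenous
  curve, hence one of the two preimages of \<open>P0\<close>, with abscissas \<open>2 * p\<close>
  and \<open>10 * q\<close>. Neither is a square.\<close>

lemma P0_not_double:
  assumes R: "R \<in> ec_points (- of_int D :: rat) 0"
  shows "ec_add (- of_int D) R R \<noteq> P0"
proof
  assume "ec_add (- of_int D) R R = P0"
  then have "ec_add (- of_int D) R R = Affine (of_int (4 * s ^ 2)) (of_int (s * (p - 5 * q)))"
    by (simp only: P0_def)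
  from double_x_coordinate[OF R this]
  obtain x y :: rat where xy: "y \<noteq> 0" "y ^ 2 = x ^ 3 - of_int D * x"
    "of_int (4 * s ^ 2) = (x ^ 2 + of_int D) ^ 2 / (4 * y ^ 2)" .
  have x: "x \<noteq> 0" using xy(1,2) by auto
  have "of_int (p + 5 * q) = (of_int (8 * s ^ 2) :: rat)" using s by simp
  then have s': "of_int p + 5 * of_int q = 8 * (of_int s :: rat) ^ 2" by simp
  have dbl: "16 * of_int s ^ 2 * y ^ 2 = (x ^ 2 + of_int D) ^ 2"
    using xy(1,3) by (simp add: field_simps)
  define t where "t = y / x"
  have t: "y = t * x" using x by (simp add: t_def)
  have "x * (t ^ 2 * x) = x * (x ^ 2 - of_int D)"
    using xy(2) unfolding t by Groebner_Basis.algebra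
  then have tx: "t ^ 2 * x = x ^ 2 - of_int D" using x by simp
  have D': "of_int D = 5 * of_int p * (of_int q :: rat)" by simp
  have "x ^ 2 * ((t ^ 2 - 2 * of_int p) * (t ^ 2 - 10 * of_int q)) = 0"
    using dbl tx s' unfolding t D' by Groebner_Basis.algebra
  then have "t ^ 2 = of_int (2 * p) \<or> t ^ 2 = of_int (10 * q)" using x by simp
  then show False using not_rat_squares by blast
qed

lemma has_rank_1: "has_rank (ec_group (- of_int D :: rat) 0) 1"
proof -
  define a :: rat where "a = - of_int D"
  note E = elliptic[folded a_def] and P0_in = P0_in[folded a_def] and double_x_pos = double_x_pos[folded a_def]
    and P0_not_double = P0_not_double[folded a_def] and reps = coset_representatives[folded a_def]
  let ?T = "Affine 0 0 :: rat point"
  interpret comm_group "ec_group a 0"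
    by (rule comm_group_ec_group[OF E])
  have G: "carrier (ec_group a 0) = ec_points a 0" "monoid.mult (ec_group a 0) = ec_add a"
    "\<one>\<^bsub>ec_group a 0\<^esub> = Infinity"
    by (simp_all add: ec_group_def)
  have T: "?T \<in> ec_points a 0" by simp
  have TP: "ec_add a ?T P0 = Affine (a / of_int (4 * s ^ 2)) (- (a * of_int (s * (p - 5 * q)) / of_int (4 * s ^ 2) ^ 2))"
  proof -
    have "ec_add a ?T P0 = ec_add a P0 ?T" by (rule ec_add_commute[OF E T P0_in])
    also have "\<dots> = Affine (a / of_int (4 * s ^ 2)) (- (a * of_int (s * (p - 5 * q)) / of_int (4 * s ^ 2) ^ 2))"
      unfolding P0_def by (rule ec_add_origin[OF E])
        (use P0_in s_nz in \<open>simp_all add: P0_def\<close>)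
    finally show ?thesis .
  qed
  have T2: "ec_add a Q Q = Infinity \<longleftrightarrow> Q = Infinity \<or> Q = ?T" if "Q \<in> ec_points a 0" for Q
  proof (cases Q)
    case (Affine x y)
    have "ec_add a Q Q = Infinity \<longleftrightarrow> y = 0"
      using Affine by (simp add: ec_add.simps(3) Let_def eq_neg_self_iff)
    moreover have "x = 0" if "y = 0"
    proof -
      have "y ^ 2 = x ^ 3 - of_int D * x"
        using \<open>Q \<in> ec_points a 0\<close> Affine by (simp add: a_def)
      then have "x * (x ^ 2 - of_int D) = 0"
        using that by Groebner_Basis.algebra
      then show ?thesis using not_rat_squares(1)[of x] by auto
    qed
    ultimately show ?thesis using Affine by auto
  qed simp
  obtain C where C: "\<And>Q. Q \<in> ec_points a 0 \<Longrightarrow> point_height (ec_add a Q P0) \<le> C * point_height Q ^ 2"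
    using point_height_add[OF elliptic D_pos, folded a_def P0_def] P0_in
    unfolding P0_def by blast
  \<comment> \<open>The factors are the losses in doubling, in adding \<open>P0\<close> and in
    adding \<open>(0, 0)\<close>, the last squared since the bound for adding \<open>P0\<close> is
    quadratic. The \<open>+ 1\<close> covers the case in which \<open>P0\<close> is not
    added.\<close>
  define B where "B = nat (64 * D ^ 5) * (C + 1) * nat D ^ 2"
  have B1: "1 \<le> B"
  proof -
    have "1 \<le> nat (64 * D ^ 5)" using zero_less_power[OF D_pos, of 5] by linarith
    moreover have "1 \<le> nat D ^ 2" using D_pos by (intro one_le_power) linarith
    ultimately have "1 * 1 * 1 \<le> B" unfolding B_def by (intro mult_le_mono) simp_all
    then show ?thesis by simp
  qed
  have H1: "point_height Infinity ^ 2 \<le> B * point_height Q" for Q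
    using mult_le_mono[OF B1 point_height_ge_1[of Q]] by simp
  have P0c: "P0 \<in> carrier (ec_group a 0)"
    using P0_in by (simp only: G(1))
  have P0_1: "P0 [^]\<^bsub>ec_group a 0\<^esub> (1 :: int) = P0"
    using P0c by (rule int_pow_1)
  have neg_P0: "P0 [^]\<^bsub>ec_group a 0\<^esub> (- 1 :: int) = ec_neg P0"
  proof -
    have "inv\<^bsub>ec_group a 0\<^esub> P0 = ec_neg P0"
      using P0_in by (intro inv_equality) (simp_all add: G)
    then show ?thesis using P0_in int_pow_neg[of P0 1] P0_1 by (simp add: G(1))
  qed
  have B_height: "point_height R ^ 2 \<le> B * point_height Q"
    if "Q \<in> ec_points a 0" "R \<in> ec_points a 0" "T \<in> {Infinity, ?T}"
      and RQ: "ec_add a R R = ec_add a Q T \<or> ec_add a R R = ec_add a (ec_add a Q T) P0" for Q R T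
  proof -
    have QT: "ec_add a Q T \<in> ec_points a 0"
      using that by (intro ec_add_closed[OF E]) auto
    have sq: "k \<le> k ^ 2" for k :: nat by (cases k) (auto simp: power2_eq_square)
    have "point_height (ec_add a R R) \<le> (C + 1) * point_height (ec_add a Q T) ^ 2"
      using RQ C[OF QT] sq[of "point_height (ec_add a Q T)"] by (auto simp: algebra_simps)
    also have "\<dots> \<le> (C + 1) * (nat D * point_height Q) ^ 2"
      using that by (intro mult_left_mono power_mono point_height_translate_origin[OF elliptic D_pos, folded a_def]) auto
    finally have "nat (64 * D ^ 5) * point_height (ec_add a R R) \<le> nat (64 * D ^ 5) * ((C + 1) * (nat D * point_height Q) ^ 2)"
      by (rule mult_le_mono2)
    also have "\<dots> = B * point_height Q ^ 2" by (simp only: B_def power_mult_distrib mult.assoc)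
    also have "\<dots> \<le> B ^ 2 * point_height Q ^ 2" using sq[of B] by (rule mult_le_mono1)
    finally have "point_height R ^ 4 \<le> (B * point_height Q) ^ 2"
      using point_height_double[OF elliptic D_pos not_rat_squares(1) that(2)[unfolded a_def], folded a_def] by (simp add: power_mult_distrib)
    then have "(point_height R ^ 2) ^ 2 \<le> (B * point_height Q) ^ 2" by simp
    then show ?thesis by (rule power2_le_imp_le) simp
  qed
  show ?thesis unfolding a_def[symmetric]
  proof (rule has_rank_1_descent[where P = P0 and T = ?T and H = point_height and B = B], unfold G)
    fix Q assume "Q \<in> ec_points a 0"
    show "?T \<noteq> ec_add a Q Q" using double_x_pos[OF \<open>Q \<in> _\<close>, of 0 0] by auto
    show "P0 \<noteq> ec_add a Q Q" using P0_not_double[OF \<open>Q \<in> _\<close>] by auto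
    have "a / of_int (4 * s ^ 2) < 0" using D_pos s_nz by (simp add: a_def divide_less_0_iff del: of_int_mult)
    then show "ec_add a ?T P0 \<noteq> ec_add a Q Q" using double_x_pos[OF \<open>Q \<in> _\<close>] unfolding TP
      by (metis less_asym)
  next
    fix n show "finite {P \<in> ec_points a 0. point_height P \<le> n}" by (rule finite_point_height_le)
  next
    fix Q assume Q: "Q \<in> ec_points a 0"
    show "\<exists>R\<in>ec_points a 0. \<exists>n::int. \<exists>t\<in>{Infinity, ?T}.
        Q = ec_add a (ec_add a (P0 [^]\<^bsub>ec_group a 0\<^esub> n) t) (ec_add a R R)
        \<and> point_height R ^ 2 \<le> B * point_height Q"
    proof -
      \<comment> \<open>Solving for \<open>Q\<close> changes the sign of \<open>n\<close> but not
        \<open>t\<close>, because \<open>t\<close> is its own inverse.\<close>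
      have Q_eq: "Q = ec_add a (ec_add a (P0 [^]\<^bsub>ec_group a 0\<^esub> (- n)) t) (ec_add a R R)"
        if "R \<in> ec_points a 0" "t \<in> {Infinity, ?T}"
          "ec_add a (ec_add a Q t) (P0 [^]\<^bsub>ec_group a 0\<^esub> n) = ec_add a R R" for R t and n :: int
      proof -
        have t: "t \<in> ec_points a 0" "ec_add a t t = Infinity" using that(2) T2[OF T] by auto
        have tc: "t \<in> carrier (ec_group a 0)" and Qc: "Q \<in> carrier (ec_group a 0)"
          using t(1) Q by (simp_all only: G(1))
        have inv: "P0 [^]\<^bsub>ec_group a 0\<^esub> (- n) \<otimes>\<^bsub>ec_group a 0\<^esub> P0 [^]\<^bsub>ec_group a 0\<^esub> n = \<one>\<^bsub>ec_group a 0\<^esub>"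
          using P0c by (simp add: int_pow_neg)
        have "P0 [^]\<^bsub>ec_group a 0\<^esub> (- n) \<otimes>\<^bsub>ec_group a 0\<^esub> t \<otimes>\<^bsub>ec_group a 0\<^esub> (Q \<otimes>\<^bsub>ec_group a 0\<^esub> t \<otimes>\<^bsub>ec_group a 0\<^esub> P0 [^]\<^bsub>ec_group a 0\<^esub> n)
          = (P0 [^]\<^bsub>ec_group a 0\<^esub> (- n) \<otimes>\<^bsub>ec_group a 0\<^esub> P0 [^]\<^bsub>ec_group a 0\<^esub> n) \<otimes>\<^bsub>ec_group a 0\<^esub> (t \<otimes>\<^bsub>ec_group a 0\<^esub> t) \<otimes>\<^bsub>ec_group a 0\<^esub> Q"
          using P0c Qc tc by (simp add: m_ac)
        also have "\<dots> = Q" using inv t by (simp add: G)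
        finally show ?thesis using that(3) by (simp add: G)
      qed
      show ?thesis
      proof (cases "Q = Infinity \<or> (\<exists>y. Q = Affine 0 y)")
        case True
        then have "Q \<in> {Infinity, ?T}" using Q by auto
        then show ?thesis
          using H1[of Q] by (intro bexI[of _ Infinity] exI[of _ "0::int"] bexI[of _ Q]) (simp_all add: G(3))
      next
        case False
        then obtain x y where xy: "Q = Affine x y" "x \<noteq> 0" by (cases Q) auto
        obtain t where t: "t \<in> {Infinity, ?T}" and
          cases: "ec_add a Q t \<in> {P0, ec_neg P0}
            \<or> (\<exists>R\<in>ec_points a 0. ec_add a R R = ec_add a Q t)
            \<or> (\<exists>R\<in>ec_points a 0. ec_add a R R = ec_add a (ec_add a Q t) P0)"
          using reps[of x y] Q xy by metis
        from cases consider "ec_add a Q t = P0" | "ec_add a Q t = ec_neg P0"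
          | R where "R \<in> ec_points a 0" "ec_add a R R = ec_add a Q t"
          | R where "R \<in> ec_points a 0" "ec_add a R R = ec_add a (ec_add a Q t) P0"
          by blast
        then obtain R and n :: int where R: "R \<in> ec_points a 0"
          "ec_add a (ec_add a Q t) (P0 [^]\<^bsub>ec_group a 0\<^esub> n) = ec_add a R R"
          "point_height R ^ 2 \<le> B * point_height Q"
        proof cases
          case 1
          have "P0 [^]\<^bsub>ec_group a 0\<^esub> (- 1 :: int) = ec_neg P0" using neg_P0 .
          then show ?thesis using 1 that[of Infinity "- 1"] H1[of Q] by simp
        next
          case 2
          then show ?thesis using that[of Infinity 1] H1[of Q] P0_1 by simp
        next
          case 3
          then show ?thesis using that[of R 0] B_height[OF Q 3(1) t] by (simp add: G(3))
        next
          case 4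
          then show ?thesis using that[of R 1] B_height[OF Q 4(1) t] P0_1 by simp
        qed
        then show ?thesis using Q_eq[OF R(1) t R(2)] t by blast
      qed
    qed
  qed (use P0_in T2 in simp_all)
qed

end

theorem theorem1p2:
  fixes p q k l :: int
  assumes "prime p" and "prime q"
    and "p = 40 * k + 33" and "q = 40 * l + 27"
    and "is_square (5 * k + 25 * l + 21)"
  shows "elliptic_curve (- 5 * rat_of_int p * rat_of_int q) 0 \<and>
    has_rank (ec_group (- 5 * rat_of_int p * rat_of_int q) 0) 1"
proof -
  from assms(5) obtain s where s: "5 * k + 25 * l + 21 = s ^ 2"
    by (elim is_nth_powerE)
  interpret descent_primes p q s
  proof
    \<comment> \<open>The constants agree because \<open>33 + 5 * 27 = 8 * 21\<close>.\<close>
    show "p + 5 * q = 8 * s ^ 2" unfolding s[symmetric] assms(3,4) by simp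
    show "p mod 40 = 33" "q mod 40 = 27" unfolding assms(3,4) by presburger+
  qed (fact assms)+
  show ?thesis
    using elliptic has_rank_1 by simp
qed

end
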